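(* Let $n\ge 1$ be an integer, let $(\mathcal{A},\varphi)$ be a $*$-probability space, let $\{e_{ij}\}_{i,j=1}^n\subseteq\mathcal{A}$ be a family of matrix units of $\mathcal{A}$, and let $x=x^*\in\mathcal{A}$ be freely independent from $\{e_{ij}\}_{i,j=1}^n$. Let $x_{ij}:=e_{1i}\,x\,e_{j1}\in\tilde{\mathcal{A}}$ and $$\tilde{x}^\Gamma:=\sum_{i,j=1}^n E_{ij}\otimes x_{ji}\in\mathcal{M}_n(\mathbb{C})\otimes\tilde{\mathcal{A}}.$$ Then for every integer $p\ge 1$, the $p$-th free cumulant of $\tilde{x}^\Gamma$ computed in the $*$-probability space $(\mathcal{M}_n(\mathbb{C})\otimes\tilde{\mathcal{A}},\ \mathrm{tr}_n\otimes\psi)$ and the $p$-th free cumulant of $x/n$ computed in $(\mathcal{A},\varphi)$ satisfy $$\kappa_p\big[\tilde{x}^\Gamma,\ldots,\tilde{x}^\Gamma\big]=c(n,p)\,\kappa_p\Big[\tfrac{x}{n},\ldots,\tfrac{x}{n}\Big],\qquad c(n,p)=\begin{cases} n, & p\ \text{odd},\\ n^2, & p\ \text{even}.\end{cases}$$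
   Context: A $*$-probability space $(\mathcal{A},\varphi)$ is a unital $*$-algebra $\mathcal{A}$ over $\mathbb{C}$ with a positive linear functional $\varphi$ satisfying $\varphi(\mathbf{1}_{\mathcal{A}})=1$. A family $\{e_{ij}\}_{i,j=1}^n\subseteq\mathcal{A}$ is a family of matrix units of $\mathcal{A}$ if (i) $e_{ij}^*=e_{ji}$ and $e_{ij}e_{kl}=\delta_{jk}e_{il}$ for all $i,j,k,l$; (ii) $\sum_{i=1}^n e_{ii}=\mathbf{1}_{\mathcal{A}}$; (iii) $\varphi(e_{ij})=0$ for $i\ne j$ and $\varphi(e_{11})=\cdots=\varphi(e_{nn})=1/n$. The compression of $(\mathcal{A},\varphi)$ by $e_{11}$ is $(\tilde{\mathcal{A}},\psi)$ with $\tilde{\mathcal{A}}:=e_{11}\mathcal{A}e_{11}$ (unit $e_{11}$) and $\psi:=n\cdot\varphi|_{\tilde{\mathcal{A}}}$; it is a $*$-probability space. $\{E_{ij}\}$ denotes the standard matrix units of $\mathcal{M}_n(\mathbb{C})$ and $\mathrm{tr}_n=\frac1n\mathrm{Tr}$. For a $*$-probability space $(\mathcal{B},\phi)$, the free cumulants $(\kappa_p)_{p\ge1}$ are the unique multilinear functionals such that for all $p$ and $y_1,\dots,y_p\in\mathcal{B}$, $\phi(y_1\cdots y_p)=\sum_{\pi\in NC(p)}\kappa_\pi[y_1,\ldots,y_p]$, where $NC(p)$ is the set of non-crossing partitions of $\{1,\dots,p\}$ and $\kappa_\pi[y_1,\dots,y_p]=\prod_{V=\{i_1<\dots<i_r\}\in\pi}\kappa_r[y_{i_1},\dots,y_{i_r}]$.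 *)

theory Defs
  imports Complex_Main "HOL-Library.Disjoint_Sets"
begin

record 'a staralg =
  carr :: "'a set"
  pls  :: "'a \<Rightarrow> 'a \<Rightarrow> 'a"
  tms  :: "'a \<Rightarrow> 'a \<Rightarrow> 'a"
  scl  :: "complex \<Rightarrow> 'a \<Rightarrow> 'a"
  zr   :: 'a
  un   :: 'a
  st   :: "'a \<Rightarrow> 'a"
  fn   :: "'a \<Rightarrow> complex"

definition star_prob_space :: "('a, 'b) staralg_scheme \<Rightarrow> bool" where
  "star_prob_space S \<longleftrightarrow>
     zr S \<in> carr S \<and> un S \<in> carr S \<and>
     (\<forall>a\<in>carr S. \<forall>b\<in>carr S. pls S a b \<in> carr S \<and> tms S a b \<in> carr S) \<and>
     (\<forall>a\<in>carr S. \<forall>\<alpha>. scl S \<alpha> a \<in> carr S) \<and>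
     (\<forall>a\<in>carr S. st S a \<in> carr S) \<and>
     \<comment> \<open>complex vector space\<close>
     (\<forall>a\<in>carr S. \<forall>b\<in>carr S. \<forall>c\<in>carr S. pls S (pls S a b) c = pls S a (pls S b c)) \<and>
     (\<forall>a\<in>carr S. \<forall>b\<in>carr S. pls S a b = pls S b a) \<and>
     (\<forall>a\<in>carr S. pls S a (zr S) = a) \<and>
     (\<forall>a\<in>carr S. pls S a (scl S (-1) a) = zr S) \<and>
     (\<forall>a\<in>carr S. \<forall>b\<in>carr S. \<forall>\<alpha>. scl S \<alpha> (pls S a b) = pls S (scl S \<alpha> a) (scl S \<alpha> b)) \<and>
     (\<forall>a\<in>carr S. \<forall>\<alpha> \<beta>. scl S (\<alpha> + \<beta>) a = pls S (scl S \<alpha> a) (scl S \<beta> a)) \<and>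
     (\<forall>a\<in>carr S. \<forall>\<alpha> \<beta>. scl S \<alpha> (scl S \<beta> a) = scl S (\<alpha> * \<beta>) a) \<and>
     (\<forall>a\<in>carr S. scl S 1 a = a) \<and>
     \<comment> \<open>unital associative algebra\<close>
     (\<forall>a\<in>carr S. \<forall>b\<in>carr S. \<forall>c\<in>carr S. tms S (tms S a b) c = tms S a (tms S b c)) \<and>
     (\<forall>a\<in>carr S. tms S (un S) a = a \<and> tms S a (un S) = a) \<and>
     (\<forall>a\<in>carr S. \<forall>b\<in>carr S. \<forall>c\<in>carr S.
        tms S a (pls S b c) = pls S (tms S a b) (tms S a c) \<and>
        tms S (pls S a b) c = pls S (tms S a c) (tms S b c)) \<and>
     (\<forall>a\<in>carr S. \<forall>b\<in>carr S. \<forall>\<alpha>.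
        tms S (scl S \<alpha> a) b = scl S \<alpha> (tms S a b) \<and> tms S a (scl S \<alpha> b) = scl S \<alpha> (tms S a b)) \<and>
     \<comment> \<open>involution\<close>
     (\<forall>a\<in>carr S. st S (st S a) = a) \<and>
     (\<forall>a\<in>carr S. \<forall>b\<in>carr S. st S (pls S a b) = pls S (st S a) (st S b)) \<and>
     (\<forall>a\<in>carr S. \<forall>\<alpha>. st S (scl S \<alpha> a) = scl S (cnj \<alpha>) (st S a)) \<and>
     (\<forall>a\<in>carr S. \<forall>b\<in>carr S. st S (tms S a b) = tms S (st S b) (st S a)) \<and>
     \<comment> \<open>positive unital linear functional\<close>
     (\<forall>a\<in>carr S. \<forall>b\<in>carr S. fn S (pls S a b) = fn S a + fn S b) \<and>
     (\<forall>a\<in>carr S. \<forall>\<alpha>. fn S (scl S \<alpha> a) = \<alpha> * fn S a) \<and>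
     fn S (un S) = 1 \<and>
     (\<forall>a\<in>carr S. Im (fn S (tms S (st S a) a)) = 0 \<and> Re (fn S (tms S (st S a) a)) \<ge> 0)"

fun lprod :: "('a, 'b) staralg_scheme \<Rightarrow> 'a list \<Rightarrow> 'a" where
  "lprod S [] = un S"
| "lprod S (a # as) = tms S a (lprod S as)"

fun rsum :: "('a, 'b) staralg_scheme \<Rightarrow> (nat \<Rightarrow> 'a) \<Rightarrow> nat \<Rightarrow> 'a" where
  "rsum S f 0 = zr S"
| "rsum S f (Suc k) = pls S (rsum S f k) (f k)"

definition matrix_units :: "('a, 'b) staralg_scheme \<Rightarrow> nat \<Rightarrow> (nat \<Rightarrow> nat \<Rightarrow> 'a) \<Rightarrow> bool" where
  "matrix_units S n e \<longleftrightarrow>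
     (\<forall>i<n. \<forall>j<n. e i j \<in> carr S) \<and>
     (\<forall>i<n. \<forall>j<n. st S (e i j) = e j i) \<and>
     (\<forall>i<n. \<forall>j<n. \<forall>k<n. \<forall>l<n. tms S (e i j) (e k l) = (if j = k then e i l else zr S)) \<and>
     rsum S (\<lambda>i. e i i) n = un S \<and>
     (\<forall>i<n. \<forall>j<n. i \<noteq> j \<longrightarrow> fn S (e i j) = 0) \<and>
     (\<forall>i<n. fn S (e i i) = 1 / of_nat n)"

inductive_set gen_alg :: "('a, 'b) staralg_scheme \<Rightarrow> 'a set \<Rightarrow> 'a set"
  for S :: "('a, 'b) staralg_scheme" and X :: "'a set" where
  gen: "a \<in> X \<Longrightarrow> a \<in> gen_alg S X"
| unit: "un S \<in> gen_alg S X"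
| plus: "a \<in> gen_alg S X \<Longrightarrow> b \<in> gen_alg S X \<Longrightarrow> pls S a b \<in> gen_alg S X"
| times: "a \<in> gen_alg S X \<Longrightarrow> b \<in> gen_alg S X \<Longrightarrow> tms S a b \<in> gen_alg S X"
| scale: "a \<in> gen_alg S X \<Longrightarrow> scl S \<alpha> a \<in> gen_alg S X"
| star: "a \<in> gen_alg S X \<Longrightarrow> st S a \<in> gen_alg S X"

definition free_indep :: "('a, 'b) staralg_scheme \<Rightarrow> 'a set \<Rightarrow> 'a set \<Rightarrow> bool" where
  "free_indep S X Y \<longleftrightarrow>
     (\<forall>as :: 'a list. \<forall>ls :: bool list.
        length as = length ls \<and> as \<noteq> [] \<and>
        (\<forall>k. Suc k < length ls \<longrightarrow> ls ! k \<noteq> ls ! Suc k) \<and>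
        (\<forall>k<length as. as ! k \<in> gen_alg S (if ls ! k then X else Y) \<and> fn S (as ! k) = 0)
        \<longrightarrow> fn S (lprod S as) = 0)"

definition NC :: "nat \<Rightarrow> nat set set set" where
  "NC p = {\<pi>. partition_on {0..<p} \<pi> \<and>
     (\<forall>V\<in>\<pi>. \<forall>W\<in>\<pi>. \<forall>a b c d. a < b \<and> b < c \<and> c < d \<and> a \<in> V \<and> c \<in> V \<and> b \<in> W \<and> d \<in> W
        \<longrightarrow> V = W)}"

definition cumulant_family :: "('a, 'b) staralg_scheme \<Rightarrow> (nat \<Rightarrow> 'a list \<Rightarrow> complex) \<Rightarrow> bool" where
  "cumulant_family S \<kappa> \<longleftrightarrow>
     (\<forall>ys. ys \<noteq> [] \<and> set ys \<subseteq> carr S \<longrightarrow>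
        fn S (lprod S ys) = (\<Sum>\<pi>\<in>NC (length ys). \<Prod>V\<in>\<pi>. \<kappa> (card V) (nths ys V))) \<and>
     (\<forall>ys i \<alpha> u v. set ys \<subseteq> carr S \<and> i < length ys \<and> u \<in> carr S \<and> v \<in> carr S \<longrightarrow>
        \<kappa> (length ys) (ys[i := pls S (scl S \<alpha> u) v])
          = \<alpha> * \<kappa> (length ys) (ys[i := u]) + \<kappa> (length ys) (ys[i := v]))"

definition free_cumulant :: "('a, 'b) staralg_scheme \<Rightarrow> nat \<Rightarrow> 'a list \<Rightarrow> complex" where
  "free_cumulant S p ys = (SOME \<kappa>. cumulant_family S \<kappa>) p ys"

text \<open>Compression by a projection e (here e = e_11): carrier e A e, unit e, state n * phi.\<close>
definition compress :: "'a staralg \<Rightarrow> 'a \<Rightarrow> nat \<Rightarrow> 'a staralg" where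
  "compress S e n = S\<lparr>carr := {tms S (tms S e a) e | a. a \<in> carr S}, un := e,
                       fn := (\<lambda>a. of_nat n * fn S a)\<rparr>"

text \<open>M_n(C) tensor R, realised as n x n matrices over R (zero outside the index range),
  with state tr_n tensor phi_R.\<close>
definition mat_alg :: "nat \<Rightarrow> 'a staralg \<Rightarrow> (nat \<Rightarrow> nat \<Rightarrow> 'a) staralg" where
  "mat_alg n R = \<lparr>
     carr = {M. (\<forall>i<n. \<forall>j<n. M i j \<in> carr R) \<and> (\<forall>i j. \<not> (i < n \<and> j < n) \<longrightarrow> M i j = zr R)},
     pls = (\<lambda>M N i j. if i < n \<and> j < n then pls R (M i j) (N i j) else zr R),
     tms = (\<lambda>M N i j. if i < n \<and> j < n then rsum R (\<lambda>k. tms R (M i k) (N k j)) n else zr R),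
     scl = (\<lambda>\<alpha> M i j. if i < n \<and> j < n then scl R \<alpha> (M i j) else zr R),
     zr = (\<lambda>i j. zr R),
     un = (\<lambda>i j. if i < n \<and> j < n \<and> i = j then un R else zr R),
     st = (\<lambda>M i j. if i < n \<and> j < n then st R (M j i) else zr R),
     fn = (\<lambda>M. (\<Sum>i<n. fn R (M i i)) / of_nat n)\<rparr>"

text \<open>x~^Gamma = sum_{i,j} E_ij (x) x_ji with x_ij = e_1i x e_j1; entry (i,j) is e_1j x e_i1
  (0-based: index 1 becomes 0).\<close>
definition xGamma :: "'a staralg \<Rightarrow> nat \<Rightarrow> (nat \<Rightarrow> nat \<Rightarrow> 'a) \<Rightarrow> 'a \<Rightarrow> nat \<Rightarrow> nat \<Rightarrow> 'a" where
  "xGamma S n e x = (\<lambda>i j. if i < n \<and> j < n then tms S (tms S (e 0 j) x) (e i 0) else zr S)"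

definition cnp :: "nat \<Rightarrow> nat \<Rightarrow> nat" where
  "cnp n p = (if odd p then n else n ^ 2)"

end

theory Submission
  imports Defs
begin

text \<open>A joint moment of \<open>x\<close> and the matrix units is expanded along the block, in the sense of non-crossing
  partitions, of the first \<open>x\<close>: \<open>\<phi>(x w)\<close> is the sum of \<open>\<kappa>\<^sub>r \<phi>(w\<^sub>1) \<dots> \<phi>(w\<^sub>r)\<close> over the factorisations
  \<open>w = w\<^sub>1 x w\<^sub>2 x \<dots> x w\<^sub>r\<close>. By linearity it suffices to check this, and the traciality of \<open>\<phi>\<close>, on products
  of centred alternating factors, where freeness makes both sides explicit. The powers of
  \<open>\<Sum> E\<^sub>i\<^sub>j \<otimes> x\<^sub>j\<^sub>i\<close> are sums over index paths of words \<open>e\<^bsub>i(0) i(2)\<^esub> x e\<^bsub>i(1) i(3)\<^esub> x \<dots>\<close>. In the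
  expansion every gap contributes a factor \<open>1/n\<close> and interchanges the two indices at its ends; summing over the
  remaining free index gives another factor \<open>n\<close> exactly when \<open>r\<close> is even. So the moments of the partial
  transpose satisfy the recursion belonging to the cumulants \<open>c(n,r) \<kappa>\<^sub>r[x/n]\<close>, and this recursion
  determines the cumulants.\<close>

section \<open>Sums over non-crossing partitions\<close>

text \<open>Two obstacles shape the argument. \<open>free_cumulant\<close> is a family picked by
  \<open>SOME\<close>, so it is reached through the moments of a single element: some family is
  shown to exist, and the block weights are recovered from the moments because the one-block
  partition enters each moment with coefficient 1. Moreover, a word coming from the partial
  transpose starts with a matrix unit, while the expansion needs a word that starts with
  \<open>x\<close>. The unit is rotated to the end, so traciality on mixed words has to be derived
  from freeness and from traciality on the units.

  The index pattern arises since entry \<open>(i,j)\<close> is \<open>e_1j x e_i1\<close>: in a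
  product of two entries the factors \<open>e_i1\<close> and \<open>e_1k\<close> merge into
  \<open>e_ik\<close>, which joins indices two steps apart. Hence a gap exchanges its pair of
  indices. A path sum with matching fixed ends equals the moment divided by \<open>n\<close>,
  already for the empty path, where it is \<open>\<phi> (e_ii) = 1/n\<close>. Solving for the moment
  multiplies every term by \<open>n\<close>, and the factors \<open>1\<close> and \<open>n\<close>
  of the free index become \<open>n\<close> and \<open>n^2\<close>.\<close>

definition crossfree :: "nat set set \<Rightarrow> bool" where
  "crossfree \<pi> \<longleftrightarrow> (\<forall>V\<in>\<pi>. \<forall>W\<in>\<pi>. \<forall>a b c d. a < b \<and> b < c \<and> c < d \<and> a \<in> V \<and> c \<in> V \<and> b \<in> W \<and> d \<in> W
        \<longrightarrow> V = W)"

definition nc_on :: "nat \<Rightarrow> nat \<Rightarrow> nat set set set" where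
  "nc_on a b = {\<pi>. partition_on {a..<b} \<pi> \<and> crossfree \<pi>}"

definition nc_sum :: "(nat \<Rightarrow> complex) \<Rightarrow> nat \<Rightarrow> nat \<Rightarrow> complex" where
  "nc_sum w a b = (\<Sum>\<pi>\<in>nc_on a b. \<Prod>V\<in>\<pi>. w (card V))"

definition nc_fst :: "nat \<Rightarrow> nat \<Rightarrow> nat \<Rightarrow> nat set set set" where
  "nc_fst r a b = {\<pi>\<in>nc_on a b. \<exists>V\<in>\<pi>. a \<in> V \<and> card V = Suc r}"

text \<open>The block of \<open>a\<close> carries no weight here, because the recursion removes its
  first element: its size changes while its weight must stay that of the original block.\<close>

definition fst_sum :: "(nat \<Rightarrow> complex) \<Rightarrow> nat \<Rightarrow> nat \<Rightarrow> nat \<Rightarrow> complex" where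
  "fst_sum w r a b = (\<Sum>\<pi>\<in>nc_fst r a b. \<Prod>V\<in>{V\<in>\<pi>. a \<notin> V}. w (card V))"

lemma NC_eq_nc_on: "NC p = nc_on 0 p"
  by (simp add: NC_def nc_on_def crossfree_def)

lemma crossfreeD:
  assumes "crossfree \<pi>" "V \<in> \<pi>" "W \<in> \<pi>" "i < j" "j < k" "k < l" "i \<in> V" "k \<in> V" "j \<in> W" "l \<in> W"
  shows "V = W"
  using assms unfolding crossfree_def by blast

lemma crossfree_subset: "crossfree \<pi> \<Longrightarrow> \<rho> \<subseteq> \<pi> \<Longrightarrow> crossfree \<rho>"
  unfolding crossfree_def by blast

lemma finite_nc_on: "finite (nc_on a b)"
  by (rule finite_subset[of _ "Pow (Pow {a..<b})"]) (auto simp: nc_on_def partition_on_def)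

lemma nc_on_block:
  assumes "\<pi> \<in> nc_on a b" "V \<in> \<pi>"
  shows "V \<subseteq> {a..<b}" "V \<noteq> {}" "finite V"
proof -
  show "V \<subseteq> {a..<b}" "V \<noteq> {}"
    using assms by (auto simp: nc_on_def partition_on_def)
  then show "finite V" using finite_subset by blast
qed

lemma nc_on_finite: "\<pi> \<in> nc_on a b \<Longrightarrow> finite \<pi>"
  using finite_elements[of "{a..<b}" \<pi>] by (auto simp: nc_on_def)

lemma nc_on_unique:
  assumes "\<pi> \<in> nc_on a b" "V \<in> \<pi>" "W \<in> \<pi>" "i \<in> V" "i \<in> W"
  shows "V = W"
  using assms by (auto simp: nc_on_def partition_on_def disjoint_def)

lemma nc_on_cover:
  assumes "\<pi> \<in> nc_on a b" "a \<le> i" "i < b"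
  shows "\<exists>V\<in>\<pi>. i \<in> V"
proof -
  have "i \<in> \<Union>\<pi>" using assms by (auto simp: nc_on_def partition_on_def)
  then show ?thesis by blast
qed

lemma nc_onI:
  assumes "\<And>V. V \<in> \<pi> \<Longrightarrow> V \<noteq> {} \<and> V \<subseteq> {a..<b}"
    and "\<And>i. a \<le> i \<Longrightarrow> i < b \<Longrightarrow> \<exists>V\<in>\<pi>. i \<in> V"
    and "\<And>V W i. V \<in> \<pi> \<Longrightarrow> W \<in> \<pi> \<Longrightarrow> i \<in> V \<Longrightarrow> i \<in> W \<Longrightarrow> V = W"
    and "crossfree \<pi>"
  shows "\<pi> \<in> nc_on a b"
proof -
  have "\<Union>\<pi> = {a..<b}"
    using assms(1,2) by fastforce
  moreover have "disjoint \<pi>" using assms(3) by (auto simp: disjoint_def)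
  ultimately show ?thesis
    using assms(1,4) by (auto simp: nc_on_def partition_on_def)
qed

lemma nc_sum_eq_fst_sum:
  assumes "a < b"
  shows "nc_sum w a b = (\<Sum>r<b - a. w (Suc r) * fst_sum w r a b)"
proof -
  have un: "nc_on a b = (\<Union>r<b - a. nc_fst r a b)"
  proof (intro equalityI subsetI)
    fix \<pi> assume p: "\<pi> \<in> nc_on a b"
    then obtain V where V: "V \<in> \<pi>" "a \<in> V" using nc_on_cover assms by blast
    have "card V \<le> b - a"
      using card_mono[OF _ nc_on_block(1)[OF p V(1)]] by simp
    moreover have "card V \<noteq> 0" using nc_on_block[OF p V(1)] by simp
    ultimately show "\<pi> \<in> (\<Union>r<b - a. nc_fst r a b)"
      using p V by (auto simp: nc_fst_def intro!: bexI[of _ "card V - 1"] bexI[of _ V])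
  qed (auto simp: nc_fst_def)
  have "nc_sum w a b = (\<Sum>r<b - a. \<Sum>\<pi>\<in>nc_fst r a b. \<Prod>V\<in>\<pi>. w (card V))"
    unfolding nc_sum_def un
  proof (rule sum.UNION_disjoint)
    show "\<forall>r\<in>{..<b - a}. finite (nc_fst r a b)"
      using finite_nc_on by (auto simp: nc_fst_def)
    show "\<forall>r\<in>{..<b - a}. \<forall>s\<in>{..<b - a}. r \<noteq> s \<longrightarrow> nc_fst r a b \<inter> nc_fst s a b = {}"
      using nc_on_unique by (fastforce simp: nc_fst_def)
  qed simp
  also have "\<dots> = (\<Sum>r<b - a. w (Suc r) * fst_sum w r a b)"
  proof (rule sum.cong[OF refl])
    fix r
    show "(\<Sum>\<pi>\<in>nc_fst r a b. \<Prod>V\<in>\<pi>. w (card V)) = w (Suc r) * fst_sum w r a b"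
      unfolding fst_sum_def sum_distrib_left
    proof (rule sum.cong[OF refl])
      fix \<pi> assume "\<pi> \<in> nc_fst r a b"
      then obtain V where p: "\<pi> \<in> nc_on a b" and V: "V \<in> \<pi>" "a \<in> V" "card V = Suc r"
        by (auto simp: nc_fst_def)
      have "{W \<in> \<pi>. a \<notin> W} = \<pi> - {V}" using V nc_on_unique[OF p] by blast
      then show "(\<Prod>V\<in>\<pi>. w (card V)) = w (Suc r) * (\<Prod>V\<in>{V \<in> \<pi>. a \<notin> V}. w (card V))"
        using prod.remove[OF nc_on_finite[OF p] V(1), of "\<lambda>V. w (card V)"] V(3) by simp
    qed
  qed
  finally show ?thesis .
qed

lemma fst_sum_0:
  assumes "a < b"
  shows "fst_sum w 0 a b = nc_sum w (Suc a) b"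
  unfolding fst_sum_def nc_sum_def
proof (rule sum.reindex_bij_witness[where i = "insert {a}" and j = "\<lambda>\<pi>. \<pi> - {{a}}"])
  fix \<pi> assume "\<pi> \<in> nc_fst 0 a b"
  then obtain V where p: "\<pi> \<in> nc_on a b" and V: "V \<in> \<pi>" "a \<in> V" "card V = 1"
    by (auto simp: nc_fst_def)
  then have a: "{a} \<in> \<pi>" by (metis card_1_singletonE singletonD)
  then show "insert {a} (\<pi> - {{a}}) = \<pi>" by blast
  have other: "a \<notin> W" if "W \<in> \<pi>" "W \<noteq> {a}" for W
    using nc_on_unique[OF p that(1) a] that(2) by blast
  show "\<pi> - {{a}} \<in> nc_on (Suc a) b"
  proof (rule nc_onI)
    fix W assume W: "W \<in> \<pi> - {{a}}"
    then have "W \<subseteq> {a..<b}" "W \<noteq> {}" "a \<notin> W" using nc_on_block[OF p] other by blast+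
    moreover from this have "Suc a \<le> i" if "i \<in> W" for i
      using that by (cases "i = a") auto
    ultimately show "W \<noteq> {} \<and> W \<subseteq> {Suc a..<b}" by auto
  next
    fix i assume "Suc a \<le> i" "i < b"
    then obtain V where "V \<in> \<pi>" "i \<in> V" "i \<noteq> a" using nc_on_cover[OF p, of i] by auto
    then show "\<exists>V\<in>\<pi> - {{a}}. i \<in> V" by blast
  next
    show "crossfree (\<pi> - {{a}})"
      using p by (auto simp: nc_on_def intro: crossfree_subset)
  qed (use nc_on_unique[OF p] in blast)
  have "{V \<in> \<pi>. a \<notin> V} = \<pi> - {{a}}" using other by auto
  then show "(\<Prod>V\<in>\<pi> - {{a}}. w (card V)) = (\<Prod>V\<in>{V \<in> \<pi>. a \<notin> V}. w (card V))" by simp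
next
  fix \<pi> assume p: "\<pi> \<in> nc_on (Suc a) b"
  have a: "a \<notin> V" if "V \<in> \<pi>" for V using nc_on_block(1)[OF p that] by auto
  then show "insert {a} \<pi> - {{a}} = \<pi>" by blast
  have "insert {a} \<pi> \<in> nc_on a b"
  proof (rule nc_onI)
    fix V assume "V \<in> insert {a} \<pi>"
    then show "V \<noteq> {} \<and> V \<subseteq> {a..<b}" using nc_on_block[OF p] assms by fastforce
  next
    fix i assume i: "a \<le> i" "i < b"
    show "\<exists>V\<in>insert {a} \<pi>. i \<in> V"
    proof (cases "i = a")
      case False
      then have "\<exists>V\<in>\<pi>. i \<in> V" using nc_on_cover[OF p, of i] i by simp
      then show ?thesis by blast
    qed simp
  next
    fix V W i assume "V \<in> insert {a} \<pi>" "W \<in> insert {a} \<pi>" "i \<in> V" "i \<in> W"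
    then show "V = W" using nc_on_unique[OF p] a by (auto 4 3)
  next
    have "crossfree \<pi>" using p by (simp add: nc_on_def)
    show "crossfree (insert {a} \<pi>)" unfolding crossfree_def
    proof (intro ballI allI impI)
      fix V W i j k l
      assume VW: "V \<in> insert {a} \<pi>" "W \<in> insert {a} \<pi>"
        and *: "i < j \<and> j < k \<and> k < l \<and> i \<in> V \<and> k \<in> V \<and> j \<in> W \<and> l \<in> W"
      have "V \<noteq> {a}" "W \<noteq> {a}" using * by auto
      then show "V = W" using VW * crossfreeD[OF \<open>crossfree \<pi>\<close>] by (meson insertE)
    qed
  qed
  then show "insert {a} \<pi> \<in> nc_fst 0 a b" by (auto simp: nc_fst_def)
qed

text \<open>The blocks of the partition fall into those inside the gap between \<open>a\<close> and its successor
  \<open>v\<close> in its block, and those to the right of the gap (after removing \<open>a\<close>).\<close>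

lemma fst_sum_Suc:
  "fst_sum w (Suc r) a b = (\<Sum>v\<in>{a<..<b}. nc_sum w (Suc a) v * fst_sum w r v b)"
proof -
  \<comment> \<open>The partitions are sorted by the second smallest element \<open>v\<close> of the
    block of \<open>a\<close>.\<close>
  define P where "P v = {\<pi>\<in>nc_on a b. \<exists>V\<in>\<pi>. a \<in> V \<and> card V = Suc (Suc r) \<and> v \<in> V \<and> {a<..<v} \<inter> V = {}}" for v
  have un: "nc_fst (Suc r) a b = (\<Union>v\<in>{a<..<b}. P v)"
  proof (intro equalityI subsetI)
    fix \<pi> assume "\<pi> \<in> nc_fst (Suc r) a b"
    then obtain V where p: "\<pi> \<in> nc_on a b" and V: "V \<in> \<pi>" "a \<in> V" "card V = Suc (Suc r)"
      by (auto simp: nc_fst_def)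
    note bl = nc_on_block[OF p V(1)]
    define v where "v = Min (V - {a})"
    have ne: "V - {a} \<noteq> {}" 
    proof
      assume "V - {a} = {}"
      then have "V \<subseteq> {a}" by blast
      then have "card V \<le> 1" using card_mono[of "{a}" V] by simp
      then show False using V(3) by simp
    qed
    then have "v \<in> V - {a}" unfolding v_def using bl(3) by (intro Min_in) auto
    moreover have "v \<le> i" if "i \<in> V - {a}" for i
      using that bl(3) by (simp add: v_def)
    ultimately show "\<pi> \<in> (\<Union>v\<in>{a<..<b}. P v)"
      using p V bl(1) unfolding P_def
      by (intro UN_I[of v] CollectI conjI bexI[of _ V]) force+
  qed (auto simp: P_def nc_fst_def)
  have fin: "finite (P v)" for v using finite_nc_on by (auto simp: P_def)
  have "fst_sum w (Suc r) a b = (\<Sum>v\<in>{a<..<b}. \<Sum>\<pi>\<in>P v. \<Prod>V\<in>{V\<in>\<pi>. a \<notin> V}. w (card V))"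
    unfolding fst_sum_def un
  proof (rule sum.UNION_disjoint)
    show "\<forall>v\<in>{a<..<b}. \<forall>u\<in>{a<..<b}. v \<noteq> u \<longrightarrow> P v \<inter> P u = {}"
    proof (intro ballI impI equals0I)
      fix u v \<pi> assume uv: "v \<in> {a<..<b}" "u \<in> {a<..<b}" "v \<noteq> u" and "\<pi> \<in> P v \<inter> P u"
      then obtain V W where p: "\<pi> \<in> nc_on a b" and V: "V \<in> \<pi>" "a \<in> V" "v \<in> V" "{a<..<v} \<inter> V = {}"
        and W: "W \<in> \<pi>" "a \<in> W" "u \<in> W" "{a<..<u} \<inter> W = {}"
        unfolding P_def by blast
      have "V = W" using nc_on_unique[OF p] V W by blast
      then have "u \<notin> {a<..<v}" "v \<notin> {a<..<u}" using V W by blast+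
      then show False using uv by auto
    qed
  qed (use fin in auto)
  also have "\<dots> = (\<Sum>v\<in>{a<..<b}. nc_sum w (Suc a) v * fst_sum w r v b)"
  proof (rule sum.cong[OF refl])
    fix v assume v: "v \<in> {a<..<b}"
    \<comment> \<open>After the removal of \<open>a\<close>, its block starts at \<open>v\<close>,
      so membership of \<open>v\<close> marks the block to which \<open>a\<close> has to be
      returned.\<close>
    define h where "h W = (if v \<in> W then insert a W else W)" for W
    define join where "join = (\<lambda>(\<sigma>, \<tau>). \<sigma> \<union> h ` \<tau>)"
    define split where "split \<pi> = ({V\<in>\<pi>. V \<subseteq> {Suc a..<v}}, (\<lambda>V. V - {a}) ` {V\<in>\<pi>. \<not> V \<subseteq> {Suc a..<v}})" for \<pi>
    have "(\<Sum>\<pi>\<in>P v. \<Prod>V\<in>{V\<in>\<pi>. a \<notin> V}. w (card V)) =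
      (\<Sum>(\<sigma>,\<tau>)\<in>nc_on (Suc a) v \<times> nc_fst r v b. (\<Prod>V\<in>\<sigma>. w (card V)) * (\<Prod>V\<in>{V\<in>\<tau>. v \<notin> V}. w (card V)))"
    proof (rule sum.reindex_bij_witness[where i = join and j = split])
      fix \<pi> assume "\<pi> \<in> P v"
      then obtain V where p: "\<pi> \<in> nc_on a b" and V: "V \<in> \<pi>" "a \<in> V" "card V = Suc (Suc r)" "v \<in> V" "{a<..<v} \<inter> V = {}"
        unfolding P_def by blast
      have cf: "crossfree \<pi>" using p by (simp add: nc_on_def)
      note uq = nc_on_unique[OF p] and bl = nc_on_block[OF p]
      \<comment> \<open>A block other than \<open>V\<close> that meets the gap and also leaves it
        has points \<open>y < v < z\<close>, and these cross the points \<open>a\<close> and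
        \<open>v\<close> of \<open>V\<close>.\<close>
      have right: "W \<subseteq> {Suc v..<b}" if W: "W \<in> \<pi>" "W \<noteq> V" "\<not> W \<subseteq> {Suc a..<v}" for W
      proof
        fix y assume y: "y \<in> W"
        have aW: "a \<notin> W" "v \<notin> W" using uq W V by blast+
        have "\<not> y < v"
        proof
          assume "y < v"
          have "y \<noteq> a" "a \<le> y" using y aW bl(1)[OF W(1)] by auto
          then have "a < y" by simp
          obtain z where z: "z \<in> W" "z \<notin> {Suc a..<v}" using W(3) by blast
          have "z \<noteq> a" "a \<le> z" "z \<noteq> v" using z aW bl(1)[OF W(1)] by auto
          then have "v < z" using z(2) by auto
          then show False
            using crossfreeD[OF cf V(1) W(1) \<open>a < y\<close> \<open>y < v\<close> \<open>v < z\<close>] V y z W(2) by blast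
        qed
        moreover have "y \<noteq> v" using y aW by blast
        ultimately show "y \<in> {Suc v..<b}" using y bl(1)[OF W(1)] by auto
      qed
      have Vr: "V - {a} \<subseteq> {v..<b}"
      proof
        fix y assume y: "y \<in> V - {a}"
        then have "y \<notin> {a<..<v}" "a \<le> y" "y < b" "y \<noteq> a" using V(5) bl(1)[OF V(1)] by auto
        then show "y \<in> {v..<b}" by auto
      qed
      have Vn: "\<not> V \<subseteq> {Suc a..<v}" using V(2) by auto
      define \<sigma> where "\<sigma> = {V\<in>\<pi>. V \<subseteq> {Suc a..<v}}"
      define \<rho> where "\<rho> = {W\<in>\<pi>. W \<noteq> V \<and> \<not> W \<subseteq> {Suc a..<v}}"
      have aW: "a \<notin> W" "v \<notin> W" if "W \<in> \<pi>" "W \<noteq> V" for W using uq that V by blast+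
      have rest: "{W\<in>\<pi>. \<not> W \<subseteq> {Suc a..<v}} = insert V \<rho>" using V(1) Vn by (auto simp: \<rho>_def)
      have tau: "(\<lambda>V. V - {a}) ` {V\<in>\<pi>. \<not> V \<subseteq> {Suc a..<v}} = insert (V - {a}) \<rho>"
      proof -
        have "(\<lambda>V. V - {a}) ` \<rho> = (\<lambda>V. V) ` \<rho>"
          using aW by (intro image_cong refl) (auto simp: \<rho>_def)
        then show ?thesis unfolding rest by simp
      qed
      have split: "split \<pi> = (\<sigma>, insert (V - {a}) \<rho>)" by (simp add: split_def tau \<sigma>_def)
      have pi: "\<pi> = \<sigma> \<union> insert V \<rho>" using V(1) by (auto simp: \<sigma>_def \<rho>_def)
      have "h ` \<rho> = \<rho>"
      proof -
        have "h ` \<rho> = (\<lambda>V. V) ` \<rho>"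
          using aW by (intro image_cong refl) (auto simp: \<rho>_def h_def)
        then show ?thesis by simp
      qed
      moreover have "h (V - {a}) = V" using V v by (auto simp: h_def)
      ultimately show "join (split \<pi>) = \<pi>"
        unfolding split join_def by (simp add: pi)
      have s1: "\<sigma> \<in> nc_on (Suc a) v"
      proof (rule nc_onI)
        fix i assume i: "Suc a \<le> i" "i < v"
        then obtain W where W: "W \<in> \<pi>" "i \<in> W" using nc_on_cover[OF p, of i] v by auto
        have "i \<in> {a<..<v}" using i by auto
        then have "W \<noteq> V" using V(5) W by blast
        then have "W \<in> \<sigma>" using right W i by (fastforce simp: \<sigma>_def)
        then show "\<exists>W\<in>\<sigma>. i \<in> W" using W by blast
      next
        show "crossfree \<sigma>" using crossfree_subset[OF cf] by (auto simp: \<sigma>_def)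
      qed (use uq bl(2) in \<open>auto simp: \<sigma>_def\<close>)
      have s2: "insert (V - {a}) \<rho> \<in> nc_on v b"
      proof (rule nc_onI)
        fix W assume "W \<in> insert (V - {a}) \<rho>"
        then show "W \<noteq> {} \<and> W \<subseteq> {v..<b}"
          using right Vr V(2,4) v bl(2) by (fastforce simp: \<rho>_def)
      next
        fix i assume i: "v \<le> i" "i < b"
        then obtain W where W: "W \<in> \<pi>" "i \<in> W" using nc_on_cover[OF p, of i] v by auto
        show "\<exists>W\<in>insert (V - {a}) \<rho>. i \<in> W"
        proof (cases "W = V")
          case True then show ?thesis using W i v by auto
        next
          case False
          have "i \<notin> {Suc a..<v}" using i by simp
          then have "W \<in> \<rho>" using W False by (auto simp: \<rho>_def)
          then show ?thesis using W by blast
        qed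
      next
        fix U W i assume "U \<in> insert (V - {a}) \<rho>" "W \<in> insert (V - {a}) \<rho>" "i \<in> U" "i \<in> W"
        then show "U = W" using uq V(1) by (auto simp: \<rho>_def)
      next
        show "crossfree (insert (V - {a}) \<rho>)" unfolding crossfree_def
        proof (intro ballI allI impI)
          fix U W i j k l
          assume UW: "U \<in> insert (V - {a}) \<rho>" "W \<in> insert (V - {a}) \<rho>"
            and *: "i < j \<and> j < k \<and> k < l \<and> i \<in> U \<and> k \<in> U \<and> j \<in> W \<and> l \<in> W"
          obtain U' where U': "U' \<in> \<pi>" "U = U' - {a}" 
            using UW(1) V(1) aW by (cases "U = V - {a}") (auto simp: \<rho>_def)
          obtain W' where W': "W' \<in> \<pi>" "W = W' - {a}" 
            using UW(2) V(1) aW by (cases "W = V - {a}") (auto simp: \<rho>_def)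
          have "U' = W'" using crossfreeD[OF cf U'(1) W'(1)] * U' W' by blast
          then show "U = W" using U' W' by simp
        qed
      qed
      have "card (V - {a}) = Suc r" using V(2,3) bl(3)[OF V(1)] by simp
      then have "insert (V - {a}) \<rho> \<in> nc_fst r v b"
        using s2 V v by (auto simp: nc_fst_def)
      then show "split \<pi> \<in> nc_on (Suc a) v \<times> nc_fst r v b" using s1 split by simp
      have d: "{W \<in> insert (V - {a}) \<rho>. v \<notin> W} = \<rho>"
        using V v aW by (auto simp: \<rho>_def)
      have "{W\<in>\<pi>. a \<notin> W} = \<sigma> \<union> \<rho>" using aW V by (auto simp: \<sigma>_def \<rho>_def)
      moreover have "\<sigma> \<inter> \<rho> = {}" by (auto simp: \<sigma>_def \<rho>_def)
      moreover have "finite \<sigma>" "finite \<rho>" using nc_on_finite[OF p] by (auto simp: \<sigma>_def \<rho>_def)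
      ultimately show "(case split \<pi> of (\<sigma>, \<tau>) \<Rightarrow> (\<Prod>V\<in>\<sigma>. w (card V)) * (\<Prod>V\<in>{V \<in> \<tau>. v \<notin> V}. w (card V))) =
         (\<Prod>V\<in>{V \<in> \<pi>. a \<notin> V}. w (card V))"
        unfolding split prod.case d by (simp add: prod.union_disjoint)
    next
      fix st assume "st \<in> nc_on (Suc a) v \<times> nc_fst r v b"
      then obtain \<sigma> \<tau> V where st: "st = (\<sigma>, \<tau>)" and s: "\<sigma> \<in> nc_on (Suc a) v" and t: "\<tau> \<in> nc_on v b"
        and V: "V \<in> \<tau>" "v \<in> V" "card V = Suc r"
        by (auto simp: nc_fst_def)
      note bs = nc_on_block[OF s] and bt = nc_on_block[OF t]
      define \<rho> where "\<rho> = \<tau> - {V}"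
      have vW: "v \<notin> W" if "W \<in> \<rho>" for W using nc_on_unique[OF t _ V(1) _ V(2)] that by (auto simp: \<rho>_def)
      have "h ` \<rho> = (\<lambda>V. V) ` \<rho>"
        using vW by (intro image_cong refl) (auto simp: h_def)
      moreover have tr: "\<tau> = insert V \<rho>" using V(1) by (auto simp: \<rho>_def)
      moreover have "h V = insert a V" using V(2) by (simp add: h_def)
      ultimately have ht: "h ` \<tau> = insert (insert a V) \<rho>" by simp
      then have j: "join st = \<sigma> \<union> insert (insert a V) \<rho>" by (simp add: join_def st)
      have out: "\<not> W \<subseteq> {Suc a..<v}" "a \<notin> W" if "W \<in> \<tau>" for W
        using bt[OF that] v by fastforce+
      have ein: "{W \<in> \<sigma> \<union> insert (insert a V) \<rho>. W \<subseteq> {Suc a..<v}} = \<sigma>"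
        using bs(1) out(1) V(1) unfolding \<rho>_def by blast
      have eout: "{W \<in> \<sigma> \<union> insert (insert a V) \<rho>. \<not> W \<subseteq> {Suc a..<v}} = insert (insert a V) \<rho>"
        using bs(1) out(1) V(1) unfolding \<rho>_def by blast
      have im: "(\<lambda>V. V - {a}) ` \<rho> = (\<lambda>V. V) ` \<rho>"
        using out by (intro image_cong refl) (auto simp: \<rho>_def)
      have "insert a V - {a} = V" using out V by blast
      then show "split (join st) = st"
        unfolding j split_def ein eout using im by (simp add: st tr)
      have ri: "y = a \<or> v \<le> y" if "Z \<in> insert (insert a V) \<rho>" "y \<in> Z" for y Z
      proof -
        have "y = a \<or> (\<exists>Z\<in>\<tau>. y \<in> Z)" using that V(1) unfolding \<rho>_def by blast
        then show ?thesis using bt(1) by force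
      qed
      have le: "a < y \<and> y < v" if "Z \<in> \<sigma>" "y \<in> Z" for y Z
        using bs(1)[OF that(1)] that(2) by fastforce
      have "join st \<in> nc_on a b" unfolding j
      proof (rule nc_onI)
        fix W assume "W \<in> \<sigma> \<union> insert (insert a V) \<rho>"
        then consider "W \<in> \<sigma>" | "W = insert a V" | "W \<in> \<tau>" unfolding \<rho>_def by blast
        then show "W \<noteq> {} \<and> W \<subseteq> {a..<b}"
        proof cases
          case 1
          then show ?thesis using bs(1,2)[OF 1] v by auto
        next
          case 2
          then show ?thesis using bt(1)[OF V(1)] v by auto
        next
          case 3
          then show ?thesis using bt(1,2)[OF 3] v by auto
        qed
      next
        fix i assume i: "a \<le> i" "i < b"
        consider "i = a" | "Suc a \<le> i" "i < v" | "v \<le> i" using i by linarith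
        then show "\<exists>W\<in>\<sigma> \<union> insert (insert a V) \<rho>. i \<in> W"
        proof cases
          case 2
          have "\<exists>W\<in>\<sigma>. i \<in> W" by (rule nc_on_cover[OF s 2])
          then show ?thesis by blast
        next
          case 3
          obtain W where W: "W \<in> \<tau>" "i \<in> W" using nc_on_cover[OF t 3 i(2)] by (elim bexE)
          show ?thesis
          proof (cases "W = V")
            case True
            then show ?thesis using W by (intro bexI[of _ "insert a V"]) auto
          next
            case False
            then show ?thesis using W by (intro bexI[of _ W]) (auto simp: \<rho>_def)
          qed
        next
          case 1
          then show ?thesis by simp
        qed
      next
        fix U W i
        assume UW: "U \<in> \<sigma> \<union> insert (insert a V) \<rho>" "W \<in> \<sigma> \<union> insert (insert a V) \<rho>" "i \<in> U" "i \<in> W"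
        have no: False if "U \<in> \<sigma>" "W \<in> insert (insert a V) \<rho>" "i \<in> U" "i \<in> W" for U W
          using ri[OF that(2,4)] le[OF that(1,3)] by linarith
        have rr: "U = W" if uw: "U \<in> insert (insert a V) \<rho>" "W \<in> insert (insert a V) \<rho>" "i \<in> U" "i \<in> W" for U W
        proof -
          obtain U' W' where UW': "U' \<in> \<tau>" "U = h U'" "W' \<in> \<tau>" "W = h W'"
            using uw(1,2) unfolding ht[symmetric] by (elim imageE) blast
          have "a \<notin> U'" "a \<notin> W'" using out(2) UW' by simp_all
          moreover have "i \<in> h U'" "i \<in> h W'" using uw(3,4) UW'(2,4) by simp_all
          ultimately have "(i \<in> U' \<and> i \<in> W') \<or> (v \<in> U' \<and> v \<in> W')"
            unfolding h_def by (cases "i = a"; cases "v \<in> U'"; cases "v \<in> W'") simp_all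
          then have "U' = W'" using nc_on_unique[OF t UW'(1,3)] by blast
          then show ?thesis using UW' by simp
        qed
        consider "U \<in> \<sigma>" "W \<in> \<sigma>" | "U \<in> \<sigma>" "W \<in> insert (insert a V) \<rho>"
            | "U \<in> insert (insert a V) \<rho>" "W \<in> \<sigma>" | "U \<in> insert (insert a V) \<rho>" "W \<in> insert (insert a V) \<rho>"
          using UW(1,2) by blast
        then show "U = W"
        proof cases
          case 1 then show ?thesis using nc_on_unique[OF s 1 UW(3,4)] by simp
        next
          case 2 then show ?thesis using no[OF 2 UW(3,4)] by simp
        next
          case 3 then show ?thesis using no[OF 3(2,1) UW(4,3)] by simp
        next
          case 4 then show ?thesis using rr[OF 4 UW(3,4)] by simp
        qed
      next
        have cs: "crossfree \<sigma>" and ct: "crossfree \<tau>" using s t by (auto simp: nc_on_def)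
        show "crossfree (\<sigma> \<union> insert (insert a V) \<rho>)" unfolding crossfree_def
        proof (intro ballI allI impI)
          fix U W i j k l
          assume UW: "U \<in> \<sigma> \<union> insert (insert a V) \<rho>" "W \<in> \<sigma> \<union> insert (insert a V) \<rho>"
            and *: "i < j \<and> j < k \<and> k < l \<and> i \<in> U \<and> k \<in> U \<and> j \<in> W \<and> l \<in> W"
          consider "U \<in> \<sigma>" "W \<in> \<sigma>" | "U \<in> \<sigma>" "W \<in> insert (insert a V) \<rho>"
            | "U \<in> insert (insert a V) \<rho>" "W \<in> \<sigma>" | "U \<in> insert (insert a V) \<rho>" "W \<in> insert (insert a V) \<rho>"
            using UW by blast
          then show "U = W"
          proof cases
            case 1
            from * have **: "i < j" "j < k" "k < l" "i \<in> U" "k \<in> U" "j \<in> W" "l \<in> W" by simp_all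
            show ?thesis by (rule crossfreeD[OF cs 1 **])
          next
            case 2
            then have "a < i" "k < v" "j = a \<or> v \<le> j" using ri le * by blast+
            then show ?thesis using * by linarith
          next
            case 3
            then have "a < j" "l < v" "k = a \<or> v \<le> k" using ri le * by blast+
            then show ?thesis using * by linarith
          next
            case 4
            obtain U' where U': "U' \<in> \<tau>" "U = h U'" using 4(1) unfolding ht[symmetric] by (elim imageE)
            obtain W' where W': "W' \<in> \<tau>" "W = h W'" using 4(2) unfolding ht[symmetric] by (elim imageE)
            have hin: "y \<in> h Z \<Longrightarrow> y \<noteq> a \<Longrightarrow> y \<in> Z" for y Z by (auto simp: h_def split: if_splits)
            have "a \<le> i" using * U' bt(1)[OF U'(1)] v by (auto simp: h_def split: if_splits)
            then have ne: "j \<noteq> a" "k \<noteq> a" "l \<noteq> a" using * by auto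
            have j: "j \<in> W'" "l \<in> W'" "k \<in> U'" using hin * ne U' W' by blast+
            \<comment> \<open>If the quadruple starts at \<open>a\<close>, then \<open>v\<close>
              takes its place, as \<open>h\<close> adds \<open>a\<close> only to the block of
              \<open>v\<close>. For \<open>j = v\<close> the two blocks share \<open>v\<close>
              outright.\<close>
            have "U' = W'"
            proof (cases "i = a")
              case False
              then have "i \<in> U'" using hin * U' by blast
              then show ?thesis using crossfreeD[OF ct U'(1) W'(1)] * j by blast
            next
              case True
              then have vU: "v \<in> U'" using U' * out(2)[OF U'(1)] by (auto simp: h_def split: if_splits)
              show ?thesis
              proof (cases "j = v")
                case True then show ?thesis using vU j nc_on_unique[OF t U'(1) W'(1)] by blast
              next
                case False
                then have "v < j" using bt(1)[OF W'(1)] j by fastforce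
                then show ?thesis using crossfreeD[OF ct U'(1) W'(1) \<open>v < j\<close>] * j vU by blast
              qed
            qed
            then show ?thesis using U' W' by simp
          qed
        qed
      qed
      moreover have "card (insert a V) = Suc (Suc r)"
        using V out bt(3)[OF V(1)] by simp
      moreover have "{a<..<v} \<inter> insert a V = {}" using bt(1)[OF V(1)] by fastforce
      ultimately show "join st \<in> P v"
        unfolding P_def j using V(2) by blast
    qed
    also have "\<dots> = nc_sum w (Suc a) v * fst_sum w r v b"
      unfolding nc_sum_def fst_sum_def sum_product sum.cartesian_product ..
    finally show "(\<Sum>\<pi>\<in>P v. \<Prod>V\<in>{V\<in>\<pi>. a \<notin> V}. w (card V)) = nc_sum w (Suc a) v * fst_sum w r v b" .
  qed
  finally show ?thesis .
qed

text \<open>\<open>conv_pow M r k\<close> sums \<open>M i\<^sub>0 * \<dots> * M i\<^sub>r\<close> over \<open>i\<^sub>0 + \<dots> + i\<^sub>r + r = k\<close>: the \<open>r\<close> separators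
  between consecutive gaps are counted in \<open>k\<close>.\<close>

fun conv_pow :: "(nat \<Rightarrow> complex) \<Rightarrow> nat \<Rightarrow> nat \<Rightarrow> complex" where
  "conv_pow M 0 k = M k"
| "conv_pow M (Suc r) k = (\<Sum>i<k. M i * conv_pow M r (k - Suc i))"

lemma conv_pow_cong: "(\<And>i. i \<le> k \<Longrightarrow> M i = M' i) \<Longrightarrow> conv_pow M r k = conv_pow M' r k"
  by (induction r arbitrary: k) (auto intro!: sum.cong)

lemma conv_pow_eq_0: "k < r \<Longrightarrow> conv_pow M r k = 0"
  by (induction r arbitrary: k) (auto intro!: sum.neutral)

text \<open>The \<open>r\<close> separators use up the whole total, so all gaps are empty.\<close>

lemma conv_pow_self: "M 0 = 1 \<Longrightarrow> conv_pow M r r = 1"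
proof (induction r)
  case (Suc r)
  have "conv_pow M (Suc r) (Suc r) = (\<Sum>i<Suc r. if i = 0 then 1 else 0)"
    unfolding conv_pow.simps using Suc
    by (intro sum.cong refl) (auto simp: conv_pow_eq_0)
  then show ?case by simp
qed simp

text \<open>The hypothesis stops at \<open>l \<le> k\<close>, so that the lemma can be applied
  inside an induction on the length of the interval.\<close>

lemma fst_sum_conv_pow:
  assumes "\<And>c l. l \<le> k \<Longrightarrow> nc_sum w c (c + l) = M l"
  shows "fst_sum w r a (a + Suc k) = conv_pow M r k"
  using assms
proof (induction r arbitrary: a k)
  case 0
  have "nc_sum w (Suc a) (Suc a + k) = M k" using 0[of k "Suc a"] by simp
  then show ?case by (simp add: fst_sum_0)
next
  case (Suc r)
  have "fst_sum w (Suc r) a (a + Suc k) = (\<Sum>v\<in>{a<..<a + Suc k}. nc_sum w (Suc a) v * fst_sum w r v (a + Suc k))"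
    by (rule fst_sum_Suc)
  also have "\<dots> = (\<Sum>i<k. nc_sum w (Suc a) (Suc a + i) * fst_sum w r (Suc a + i) (a + Suc k))"
    by (rule sum.reindex_bij_witness[where i = "\<lambda>i. Suc a + i" and j = "\<lambda>v. v - Suc a"]) auto
  also have "\<dots> = (\<Sum>i<k. M i * conv_pow M r (k - Suc i))"
  proof (intro sum.cong refl arg_cong2[where f = "(*)"])
    fix i assume i: "i \<in> {..<k}"
    then show "nc_sum w (Suc a) (Suc a + i) = M i" by (intro Suc.prems) simp
    have "a + Suc k = (Suc a + i) + Suc (k - Suc i)" using i by auto
    then show "fst_sum w r (Suc a + i) (a + Suc k) = conv_pow M r (k - Suc i)"
      using Suc.IH[of "k - Suc i" "Suc a + i"] Suc.prems by simp
  qed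
  finally show ?case by simp
qed

lemma nc_on_empty: "nc_on a a = {{}}"
  by (auto simp: nc_on_def partition_on_def crossfree_def)

text \<open>Both sides obey the same recursion in \<open>l\<close>, which spares transporting
  partitions along a translation.\<close>

lemma nc_sum_shift: "nc_sum w c (c + l) = nc_sum w 0 l"
proof (induction l arbitrary: c rule: less_induct)
  case (less l)
  show ?case
  proof (cases l)
    case 0 then show ?thesis by (simp add: nc_sum_def nc_on_empty)
  next
    case (Suc k)
    have "fst_sum w r d (d + Suc k) = conv_pow (nc_sum w 0) r k" for r d
      by (rule fst_sum_conv_pow) (use less Suc in auto)
    from this[of _ c] this[of _ 0] show ?thesis
      by (simp add: nc_sum_eq_fst_sum Suc)
  qed
qed

section \<open>Moments and the weights that produce them\<close>

definition nc_moment :: "(nat \<Rightarrow> complex) \<Rightarrow> nat \<Rightarrow> complex" where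
  "nc_moment w p = (\<Sum>\<pi>\<in>NC p. \<Prod>V\<in>\<pi>. w (card V))"

lemma nc_moment_0: "nc_moment w 0 = 1"
  by (simp add: nc_moment_def NC_eq_nc_on nc_on_empty)

text \<open>A first block of size \<open>Suc r\<close> has one gap after each of its elements. These
  gaps are independent of each other by non-crossingness, which gives a convolution of
  \<open>Suc r\<close> moments.\<close>

lemma nc_moment_Suc: "nc_moment w (Suc k) = (\<Sum>r\<le>k. w (Suc r) * conv_pow (nc_moment w) r k)"
proof -
  have "fst_sum w r 0 (Suc k) = conv_pow (nc_sum w 0) r k" for r
    using fst_sum_conv_pow[of k w "nc_sum w 0" r 0] nc_sum_shift[of w] by simp
  moreover have "nc_moment w = nc_sum w 0" by (simp add: nc_moment_def nc_sum_def NC_eq_nc_on fun_eq_iff)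
  ultimately show ?thesis by (simp add: nc_sum_eq_fst_sum lessThan_Suc_atMost)
qed

text \<open>In the recursion the term \<open>r = k\<close> is the weight of \<open>Suc k\<close>
  with coefficient 1; all other terms contain moments and smaller weights, which agree by
  induction.\<close>

lemma nc_moment_inject:
  assumes "\<And>p. nc_moment u p = nc_moment w p" "p \<ge> 1"
  shows "u p = w p"
  using assms(2)
proof (induction p rule: less_induct)
  case (less p)
  then obtain k where p: "p = Suc k" by (cases p) auto
  have eq: "nc_moment u = nc_moment w" using assms by auto
  have *: "nc_moment z (Suc k) = (\<Sum>r<k. z (Suc r) * conv_pow (nc_moment z) r k) + z (Suc k)" for z
    by (simp add: nc_moment_Suc conv_pow_self nc_moment_0 flip: lessThan_Suc_atMost)
  have "(\<Sum>r<k. u (Suc r) * conv_pow (nc_moment u) r k) = (\<Sum>r<k. w (Suc r) * conv_pow (nc_moment w) r k)"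
    using less.IH p by (intro sum.cong) (auto simp: eq)
  then show ?case using *[of u] *[of w] eq p by simp
qed

text \<open>The block sizes of a partition add up to \<open>p\<close>. This passes between
  \<open>x\<close> and \<open>x/n\<close>.\<close>

lemma nc_moment_scale: "nc_moment (\<lambda>r. t ^ r * w r) p = t ^ p * nc_moment w p"
  unfolding nc_moment_def sum_distrib_left
proof (rule sum.cong[OF refl])
  fix \<pi> assume "\<pi> \<in> NC p"
  then have p: "\<pi> \<in> nc_on 0 p" by (simp add: NC_eq_nc_on)
  have "(\<Sum>V\<in>\<pi>. card V) = card (\<Union>\<pi>)"
  proof (rule card_Union_disjoint[symmetric])
    show "pairwise disjnt \<pi>"
      using nc_on_unique[OF p] unfolding pairwise_def disjnt_def by blast
  qed (use nc_on_block(3)[OF p] in blast)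
  also have "\<Union>\<pi> = {0..<p}" using p by (simp add: nc_on_def partition_on_def)
  finally have "(\<Sum>V\<in>\<pi>. card V) = p" by simp
  then show "(\<Prod>V\<in>\<pi>. t ^ card V * w (card V)) = t ^ p * (\<Prod>V\<in>\<pi>. w (card V))"
    by (simp add: prod.distrib flip: power_sum)
qed

section \<open>Mixed moments of free variables\<close>

text \<open>Words over \<open>'b option\<close>: \<open>None\<close> stands for the variable \<open>x\<close>, \<open>Some b\<close> for a letter of the other
  algebra. In \<open>alt t cs\<close> the flag \<open>t\<close> tells whether the first block is a power of \<open>x\<close>.\<close>

fun alt :: "bool \<Rightarrow> 'b option list list \<Rightarrow> bool" where
  "alt t [] \<longleftrightarrow> True"
| "alt t (c # cs) \<longleftrightarrow> c \<noteq> [] \<and> (\<forall>l\<in>set c. (l = None) = t) \<and> alt (\<not> t) cs"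

lemma alt_append: "alt t (cs @ ds) \<longleftrightarrow> alt t cs \<and> alt (t = even (length cs)) ds"
proof (induction cs arbitrary: t)
  case (Cons c cs)
  show ?case by (cases t) (simp_all add: Cons)
qed simp

lemma alt_concat: "\<exists>t cs. alt t cs \<and> concat cs = (w :: 'b option list)"
proof (induction w)
  case Nil
  have "alt True [] \<and> concat [] = ([] :: 'b option list)" by simp
  then show ?case by blast
next
  case (Cons l w)
  then obtain t cs where cs: "alt t cs" "concat cs = w" by blast
  show ?case
  proof (cases "cs \<noteq> [] \<and> (l = None) = t")
    case True
    then obtain c ds where "cs = c # ds" by (cases cs) auto
    then have "alt t ((l # c) # ds) \<and> concat ((l # c) # ds) = l # w" using cs True by auto
    then show ?thesis by blast
  next
    case False
    then have "alt (l = None) ([l] # cs) \<and> concat ([l] # cs) = l # w" using cs by (cases cs) auto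
    then show ?thesis by blast
  qed
qed

text \<open>\<open>prod_split \<rho> L w\<close> is \<open>(\<rho> \<otimes> L)\<close> applied to the free difference quotient of \<open>w\<close>, i.e. the sum of
  \<open>\<rho> u * L v\<close> over all factorisations \<open>w = u x v\<close>.\<close>

fun prod_split :: "('b option list \<Rightarrow> complex) \<Rightarrow> ('b option list \<Rightarrow> complex) \<Rightarrow> 'b option list \<Rightarrow> complex" where
  "prod_split \<rho> L [] = 0"
| "prod_split \<rho> L (l # w) = (if l = None then \<rho> [] * L w else 0) + prod_split (\<lambda>u. \<rho> (l # u)) L w"

lemma prod_split_append:
  "prod_split \<rho> L (u @ v) = prod_split \<rho> (\<lambda>z. L (z @ v)) u + prod_split (\<lambda>z. \<rho> (u @ z)) L v"
  by (induction u arbitrary: \<rho>) auto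

lemma prod_split_diff:
  "prod_split (\<lambda>u. \<rho> u - c * \<rho>' u) L w = prod_split \<rho> L w - c * prod_split \<rho>' L w"
  by (induction w arbitrary: \<rho> \<rho>') (auto simp: algebra_simps)

lemma prod_split_no_x: "None \<notin> set w \<Longrightarrow> prod_split \<rho> L w = 0"
  by (induction w arbitrary: \<rho>) auto

lemma prod_split_x_power:
  "prod_split \<rho> L (replicate k None) = (\<Sum>i<k. \<rho> (replicate i None) * L (replicate (k - Suc i) None))"
proof (induction k arbitrary: \<rho>)
  case (Suc k)
  show ?case unfolding sum.lessThan_Suc_shift by (simp add: Suc)
qed simp

text \<open>\<open>ctr L [c\<^sub>1, \<dots>, c\<^sub>m]\<close> is the linear extension of \<open>L\<close> evaluated at the product of the centred blocks
  \<open>c\<^sub>i - \<phi> c\<^sub>i\<close>.\<close>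

locale word_functional =
  fixes \<phi> :: "'b option list \<Rightarrow> complex"
begin

fun ctr :: "('b option list \<Rightarrow> complex) \<Rightarrow> 'b option list list \<Rightarrow> complex" where
  "ctr L [] = L []"
| "ctr L (c # cs) = ctr (\<lambda>v. L (c @ v)) cs - \<phi> c * ctr L cs"

lemma ctr_add: "ctr (\<lambda>v. L v + L' v) cs = ctr L cs + ctr L' cs"
  by (induction cs arbitrary: L L') (auto simp: algebra_simps)

lemma ctr_mult: "ctr (\<lambda>v. a * L v) cs = a * ctr L cs"
  by (induction cs arbitrary: L) (auto simp: algebra_simps)

lemma ctr_zero: "ctr (\<lambda>v. 0) cs = 0"
  by (induction cs) auto

lemma ctr_diff: "ctr (\<lambda>v. L v - a * L' v) cs = ctr L cs - a * ctr L' cs"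
  using ctr_add[of L "\<lambda>v. (- a) * L' v" cs] ctr_mult[of "- a" L' cs] by simp

lemma ctr_sum: "ctr (\<lambda>v. \<Sum>i\<in>I. f i v) cs = (\<Sum>i\<in>I. ctr (f i) cs)"
  by (induction I rule: infinite_finite_induct) (auto simp: ctr_zero ctr_add)

lemma ctr_snoc: "ctr L (cs @ [c]) = ctr (\<lambda>v. L (v @ c)) cs - \<phi> c * ctr L cs"
proof (induction cs arbitrary: L)
  case (Cons d cs)
  show ?case by (simp add: Cons) (simp add: algebra_simps)
qed simp

text \<open>Expanding the centred product gives the full concatenation with coefficient 1 and
  otherwise words that lack some block. Blocks are nonempty by \<open>alt\<close>, so these words
  are strictly shorter.\<close>

lemma ctr_eq_concat:
  assumes "alt t cs" "\<And>v. length v < length (concat cs) \<Longrightarrow> L v = 0"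
  shows "ctr L cs = L (concat cs)"
  using assms
proof (induction cs arbitrary: t L)
  case (Cons c cs)
  have "ctr (\<lambda>v. L (c @ v)) cs = L (c @ concat cs)"
    using Cons.prems by (intro Cons.IH[of "\<not> t"]) auto
  moreover have "ctr L cs = L (concat cs)"
    using Cons.prems by (intro Cons.IH[of "\<not> t"]) auto
  moreover have "L (concat cs) = 0" using Cons.prems by auto
  ultimately show ?case by simp
qed simp

text \<open>Every word is an alternating concatenation, hence its centred product plus shorter
  words. So centred alternating products of length at most \<open>K\<close> determine a functional
  on words of length at most \<open>K\<close>.\<close>

lemma functional_eq_0:
  assumes "\<And>t cs. alt t cs \<Longrightarrow> length (concat cs) \<le> K \<Longrightarrow> ctr L cs = 0" "length w \<le> K"
  shows "L w = 0"
  using assms(2)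
proof (induction w rule: length_induct)
  case (1 w)
  obtain t cs where cs: "alt t cs" "concat cs = w" using alt_concat by blast
  have "ctr L cs = L (concat cs)"
    by (rule ctr_eq_concat[OF cs(1)]) (use 1 cs in auto)
  then show ?case using assms(1)[OF cs(1)] cs 1 by simp
qed

text \<open>Unrolled, this is the sum of \<open>\<phi> w0 * ... * \<phi> wr\<close> over the
  factorisations \<open>w = w0 x w1 x ... x wr\<close>, the factor that accompanies the cumulant of
  order \<open>Suc r\<close>. The recursive form lets the derivation property of
  \<open>prod_split\<close> act on one separator at a time.\<close>

fun gap_moment :: "nat \<Rightarrow> 'b option list \<Rightarrow> complex" where
  "gap_moment 0 w = \<phi> w"
| "gap_moment (Suc r) w = prod_split \<phi> (gap_moment r) w"

abbreviation xpow :: "nat \<Rightarrow> 'b option list" where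
  "xpow k \<equiv> replicate k None"

lemma gap_moment_Suc: "gap_moment (Suc r) = prod_split \<phi> (gap_moment r)"
  by (rule ext) simp

lemma gap_moment_xpow: "gap_moment r (xpow k) = conv_pow (\<lambda>k. \<phi> (xpow k)) r k"
proof (induction r arbitrary: k)
  case (Suc r)
  then show ?case unfolding gap_moment.simps prod_split_x_power conv_pow.simps by simp
qed simp

text \<open>The cut falls in \<open>c\<close> or further right. The constant \<open>\<phi> c\<close>
  contains no \<open>x\<close> to cut at and drops out of the first summand; in the second the whole
  centred block moves to the left factor.\<close>

lemma ctr_prod_split_Cons:
  "ctr (prod_split \<rho> L) (c # cs) = ctr (\<lambda>v. prod_split \<rho> (\<lambda>z. L (z @ v)) c) cs
     + ctr (prod_split (\<lambda>u. \<rho> (c @ u) - \<phi> c * \<rho> u) L) cs"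
proof -
  have "prod_split (\<lambda>u. \<rho> (c @ u) - \<phi> c * \<rho> u) L
      = (\<lambda>w. prod_split (\<lambda>u. \<rho> (c @ u)) L w - \<phi> c * prod_split \<rho> L w)"
    by (simp add: fun_eq_iff prod_split_diff)
  then show ?thesis by (simp add: prod_split_append ctr_add ctr_diff)
qed

lemma alt_True_Cons: "alt True (c # cs) \<longleftrightarrow> (\<exists>k. c = xpow (Suc k)) \<and> alt False cs"
proof -
  have "(c \<noteq> [] \<and> (\<forall>l\<in>set c. l = None)) = (\<exists>k. c = xpow (Suc k))"
    by (metis Suc_length_conv in_set_replicate length_replicate list.size(3) neq_Nil_conv
        nat.distinct(1) replicate_eqI)
  then show ?thesis by auto
qed

text \<open>A cut inside a block of \<open>x\<close> leaves on its left the preceding centred blocks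
  and a partial power of \<open>x\<close>. The condition \<open>t = even (length ds)\<close> says
  that the block after \<open>ds\<close> is such a block. Generality in \<open>\<rho>\<close> lets
  the induction absorb blocks into it.\<close>

lemma ctr_prod_split_eq_0:
  assumes "alt t cs"
    and "\<And>ds a. alt t ds \<Longrightarrow> t = even (length ds) \<Longrightarrow> ctr (\<lambda>v. \<rho> (v @ xpow a)) ds = 0"
  shows "ctr (prod_split \<rho> L) cs = 0"
  using assms
proof (induction cs arbitrary: t \<rho>)
  case (Cons c cs)
  have "ctr (prod_split (\<lambda>u. \<rho> (c @ u) - \<phi> c * \<rho> u) L) cs = 0"
  proof (rule Cons.IH[of "\<not> t"])
    fix ds :: "'b option list list" and a assume "alt (\<not> t) ds" "(\<not> t) = even (length ds)"
    then show "ctr (\<lambda>v. \<rho> (c @ v @ xpow a) - \<phi> c * \<rho> (v @ xpow a)) ds = 0"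
      using Cons.prems(2)[of "c # ds" a] Cons.prems(1) by (auto simp: ctr_diff)
  qed (use Cons.prems in auto)
  moreover have "prod_split \<rho> (\<lambda>z. L (z @ v)) c = 0" for v
  proof (cases t)
    case True
    then obtain k where k: "c = xpow (Suc k)"
      using Cons.prems(1) alt_True_Cons[of c cs] by auto
    show ?thesis
      unfolding k prod_split_x_power using Cons.prems(2)[of "[]"] True by (intro sum.neutral) auto
  next
    case False
    then show ?thesis using Cons.prems(1) by (intro prod_split_no_x) auto
  qed
  ultimately show ?case unfolding ctr_prod_split_Cons by (simp add: ctr_zero)
qed simp

end

locale free_word_functional = word_functional \<phi> for \<phi> :: "'b option list \<Rightarrow> complex" +
  assumes \<phi>_Nil: "\<phi> [] = 1"
    and free: "alt t cs \<Longrightarrow> cs \<noteq> [] \<Longrightarrow> ctr \<phi> cs = 0"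
    and trace: "None \<notin> set u \<Longrightarrow> None \<notin> set v \<Longrightarrow> \<phi> (u @ v) = \<phi> (v @ u)"
begin

text \<open>The uncentred block \<open>c\<close> is its centred version plus
  \<open>\<phi> c\<close>; freeness kills both contributions as soon as another block
  follows.\<close>

lemma ctr_Cons_block:
  assumes "alt t (c # cs)"
  shows "ctr (\<lambda>v. \<phi> (c @ v)) cs = (if cs = [] then \<phi> c else 0)"
proof (cases "cs = []")
  case False
  then show ?thesis using free[OF assms] free[of "\<not> t" cs] assms by simp
qed simp

lemma ctr_block_snoc:
  assumes "alt t (cs @ [c])"
  shows "ctr (\<lambda>v. \<phi> (v @ c)) cs = (if cs = [] then \<phi> c else 0)"
proof (cases "cs = []")
  case False
  then show ?thesis using free[OF assms] free[of t cs] assms ctr_snoc[of \<phi> cs c] 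
    by (simp add: alt_append)
qed simp

text \<open>On centred alternating products the letter either forms a block of its own next to a
  power of \<open>x\<close> or joins a block of units. By freeness both sides vanish unless there is
  no block at all or a single block of units, and there \<open>trace\<close> applies.\<close>

lemma trace_letter: "\<phi> (Some b # w) = \<phi> (w @ [Some b])"
proof -
  \<comment> \<open>The factor \<open>1\<close> gives the difference the shape that
    \<open>ctr_diff\<close> expects.\<close>
  have "ctr (\<lambda>v. \<phi> (Some b # v) - 1 * \<phi> (v @ [Some b])) cs = 0" if cs: "alt t cs" for t cs
  proof -
    have l: "ctr (\<lambda>v. \<phi> (Some b # v)) cs =
      (case cs of [] \<Rightarrow> \<phi> [Some b] | c # ds \<Rightarrow> if \<not> t \<and> ds = [] then \<phi> (Some b # c) - \<phi> c * \<phi> [Some b] else 0)"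
    proof (cases cs)
      case (Cons c ds)
      show ?thesis
      proof (cases t)
        case True
        then show ?thesis using ctr_Cons_block[of False "[Some b]" cs] cs Cons by simp
      next
        case False
        then show ?thesis
          using ctr_Cons_block[of False "[Some b]" ds] ctr_Cons_block[of False "Some b # c" ds] cs Cons
          by auto
      qed
    qed simp
    have r: "ctr (\<lambda>v. \<phi> (v @ [Some b])) cs =
      (case cs of [] \<Rightarrow> \<phi> [Some b] | c # ds \<Rightarrow> if \<not> t \<and> ds = [] then \<phi> (c @ [Some b]) - \<phi> c * \<phi> [Some b] else 0)"
    proof (cases cs rule: rev_cases)
      case (snoc ds c)
      show ?thesis
      proof (cases "t = even (length ds)")
        case True
        have "alt t (cs @ [[Some b]])" using cs snoc True by (auto simp: alt_append)
        then have "ctr (\<lambda>v. \<phi> (v @ [Some b])) cs = 0" using ctr_block_snoc[of t cs] snoc by simp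
        then show ?thesis using True snoc by (cases ds) auto
      next
        case False
        then have "alt t (ds @ [[Some b]])" "alt t (ds @ [c @ [Some b]])"
          using cs snoc by (auto simp: alt_append)
        then have "ctr (\<lambda>v. \<phi> (v @ [Some b])) cs = (if ds = [] then \<phi> (c @ [Some b]) - \<phi> c * \<phi> [Some b] else 0)"
          using ctr_block_snoc[of t ds "[Some b]"] ctr_block_snoc[of t ds "c @ [Some b]"]
          by (simp add: snoc ctr_snoc)
        then show ?thesis using False snoc by (cases ds) auto
      qed
    qed simp
    have "\<phi> (Some b # c) = \<phi> (c @ [Some b])" if "cs = c # ds" "\<not> t" for c ds
      using trace[of "[Some b]" c] cs that by auto
    then show ?thesis unfolding ctr_diff l r by (auto split: list.splits)
  qed
  then have "\<phi> (Some b # w) - 1 * \<phi> (w @ [Some b]) = 0"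
    using functional_eq_0[of "length w" "\<lambda>v. \<phi> (Some b # v) - 1 * \<phi> (v @ [Some b])" w] by simp
  then show ?thesis by simp
qed

text \<open>Only the first block contributes: otherwise the left tensor factor is a product of centred
  blocks followed by a power of \<open>x\<close>.\<close>

lemma ctr_prod_split:
  assumes "alt t (c # cs)"
  shows "ctr (prod_split \<phi> L) (c # cs) = ctr (\<lambda>v. prod_split \<phi> (\<lambda>z. L (z @ v)) c) cs"
proof -
  have "ctr (prod_split (\<lambda>u. \<phi> (c @ u) - \<phi> c * \<phi> u) L) cs = 0"
  proof (rule ctr_prod_split_eq_0[where t = "\<not> t"])
    fix ds :: "'b option list list" and a assume ds: "alt (\<not> t) ds" "(\<not> t) = even (length ds)"
    have c: "alt t (c # ds)" using ds assms by auto
    have "ctr (\<lambda>v. \<phi> (v @ xpow a)) (c # ds) = 0"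
    proof (cases a)
      case 0
      then show ?thesis using free[OF c] by simp
    next
      case (Suc b)
      then have "alt t ((c # ds) @ [xpow a])" using c ds(2) by (auto simp: alt_append)
      then show ?thesis using ctr_block_snoc[of t "c # ds"] by simp
    qed
    then show "ctr (\<lambda>v. \<phi> (c @ v @ xpow a) - \<phi> c * \<phi> (v @ xpow a)) ds = 0"
      by (simp add: ctr_diff)
  qed (use assms in auto)
  then show ?thesis unfolding ctr_prod_split_Cons by simp
qed

text \<open>The two claims need each other: cutting inside a leading power of \<open>x\<close>
  leaves a shorter power, and when nothing is left the product starts with a block of units. That
  block offers no place to cut. The condition \<open>cs \<noteq> []\<close> in the second claim
  excludes a single power of \<open>x\<close>, where the cumulants themselves appear.\<close>

lemma ctr_gap_moment:
  "cs \<noteq> [] \<Longrightarrow> alt False cs \<Longrightarrow> ctr (gap_moment r) cs = 0"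
  "cs \<noteq> [] \<Longrightarrow> alt True (c # cs) \<Longrightarrow> ctr (gap_moment r) (c # cs) = 0"
proof (induction r arbitrary: c cs)
  case 0
  { case 1 then show ?case using free[of False cs] by simp
  next
    case 2 then show ?case using free[of True "c # cs"] by simp }
next
  case (Suc r)
  { case 1
    then obtain d ds where cs: "cs = d # ds" by (cases cs) auto
    have "prod_split \<phi> (\<lambda>z. gap_moment r (z @ v)) d = 0" for v
      using 1 cs by (intro prod_split_no_x) auto
    then show ?case using 1 ctr_prod_split[of False d ds "gap_moment r"] by (simp add: cs ctr_zero del: ctr.simps)
  next
    case 2
    then obtain k where k: "c = xpow (Suc k)" and cs: "alt False cs"
      unfolding alt_True_Cons by (elim conjE exE)
    have z: "ctr (\<lambda>v. gap_moment r (xpow j @ v)) cs = 0" for j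
    proof (cases j)
      case 0 then show ?thesis using Suc(1)[OF 2(1) cs] by simp
    next
      case (Suc i)
      have "alt True (xpow j # cs)" using cs Suc by (auto simp: alt_True_Cons)
      then show ?thesis using Suc.IH(2)[OF 2(1), of "xpow j"] Suc.IH(1)[OF 2(1) cs] by simp
    qed
    have "ctr (gap_moment (Suc r)) (c # cs) =
       ctr (\<lambda>v. \<Sum>i<Suc k. \<phi> (xpow i) * gap_moment r (xpow (Suc k - Suc i) @ v)) cs"
      using ctr_prod_split[OF 2(2), of "gap_moment r"] unfolding k prod_split_x_power gap_moment_Suc .
    also have "\<dots> = 0" unfolding ctr_sum ctr_mult z by simp
    finally show ?case . }
qed

text \<open>The fixed range \<open>r \<le> K\<close> makes the right side one linear functional of
  \<open>w\<close>, so it can be tested on centred products. A lone power of \<open>x\<close>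
  reduces to \<open>cum\<close>; with further blocks, or a leading block of units, both sides
  vanish.\<close>

lemma first_block_expansion:
  assumes cum: "\<And>k. \<phi> (xpow (Suc k)) = (\<Sum>r\<le>k. \<kappa> (Suc r) * gap_moment r (xpow k))"
    and "length w \<le> K"
  shows "\<phi> (None # w) = (\<Sum>r\<le>K. \<kappa> (Suc r) * gap_moment r w)"
proof -
  define H where "H = (\<lambda>w. \<phi> (None # w) - 1 * (\<Sum>r\<le>K. \<kappa> (Suc r) * gap_moment r w))"
  have cum': "\<phi> (xpow (Suc k)) = (\<Sum>r\<le>K. \<kappa> (Suc r) * gap_moment r (xpow k))" if "k \<le> K" for k
  proof -
    have "(\<Sum>r\<le>K. \<kappa> (Suc r) * gap_moment r (xpow k)) = (\<Sum>r\<le>k. \<kappa> (Suc r) * gap_moment r (xpow k))"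
      using that by (intro sum.mono_neutral_right) (auto simp: gap_moment_xpow conv_pow_eq_0)
    then show ?thesis using cum by simp
  qed
  have "ctr H cs = 0" if cs: "alt t cs" "length (concat cs) \<le> K" for t cs
  proof -
    have e: "ctr H cs = ctr (\<lambda>w. \<phi> (None # w)) cs - (\<Sum>r\<le>K. \<kappa> (Suc r) * ctr (gap_moment r) cs)"
      unfolding H_def ctr_diff ctr_sum ctr_mult by simp
    show ?thesis
    proof (cases cs)
      case Nil
      then show ?thesis unfolding e using cum'[of 0] by simp
    next
      case (Cons c ds)
      show ?thesis
      proof (cases t)
        case False
        then have "ctr (\<lambda>w. \<phi> (None # w)) cs = 0"
          using ctr_Cons_block[of True "[None]" cs] cs Cons by simp
        then show ?thesis unfolding e using ctr_gap_moment(1)[of cs] cs Cons False by simp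
      next
        case True
        then have "alt True (c # ds)" using cs(1) Cons by simp
        then obtain k where k: "c = xpow (Suc k)" and ds: "alt False ds"
          unfolding alt_True_Cons by (elim conjE exE)
        show ?thesis
        proof (cases "ds = []")
          case False
          \<comment> \<open>The extra \<open>x\<close> joins the centred first block, which turns
            into \<open>x^(k+2)\<close> minus a multiple of \<open>x\<close>.\<close>
          have "alt True (xpow (Suc (Suc k)) # ds)" "alt True (xpow 1 # ds)" using ds by auto
          from this[THEN ctr_Cons_block] have "ctr (\<lambda>w. \<phi> (None # w)) cs = 0"
            using False by (simp add: Cons k)
          then show ?thesis unfolding e using ctr_gap_moment(2)[of ds] cs Cons False True by simp
        next
          case True
          have "Suc k \<le> K" using cs Cons k True by simp
          have "H (xpow j) = 0" if "j \<le> K" for j using cum'[OF that] by (simp add: H_def)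
          from this[of 0] this[OF \<open>Suc k \<le> K\<close>] show ?thesis using Cons k True by simp
        qed
      qed
    qed
  qed
  then have "H w = 0" using assms(2) by (rule functional_eq_0)
  then show ?thesis by (simp add: H_def)
qed

end

section \<open>Words in the powers of the partial transpose\<close>

text \<open>In \<open>path_sum n k a b c d L\<close>, \<open>L\<close> is summed over the words
  \<open>e\<^bsub>i(0) i(2)\<^esub> x e\<^bsub>i(1) i(3)\<^esub> x \<dots> x e\<^bsub>i(k) i(k+2)\<^esub>\<close> with prescribed ends
  \<open>i(0) = a\<close>, \<open>i(1) = b\<close>, \<open>i(k+1) = c\<close>, \<open>i(k+2) = d\<close>. These are the words occurring in the powers of the
  partial transpose.\<close>

fun path_sum :: "nat \<Rightarrow> nat \<Rightarrow> nat \<Rightarrow> nat \<Rightarrow> nat \<Rightarrow> nat \<Rightarrow> ((nat \<times> nat) option list \<Rightarrow> complex) \<Rightarrow> complex" where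
  "path_sum n 0 a b c d L = (if b = c then L [Some (a, d)] else 0)"
| "path_sum n (Suc k) a b c d L = (\<Sum>j<n. path_sum n k b j c d (\<lambda>v. L (Some (a, j) # None # v)))"

lemma path_sum_add:
  "path_sum n k a b c d (\<lambda>v. L v + L' v) = path_sum n k a b c d L + path_sum n k a b c d L'"
  by (induction k arbitrary: a b L L') (auto simp: sum.distrib)

lemma path_sum_mult: "path_sum n k a b c d (\<lambda>v. \<alpha> * L v) = \<alpha> * path_sum n k a b c d L"
  by (induction k arbitrary: a b L) (auto simp: sum_distrib_left)

lemma path_sum_sum:
  "path_sum n k a b c d (\<lambda>v. \<Sum>i\<in>I. f i v) = (\<Sum>i\<in>I. path_sum n k a b c d (f i))"
proof (induction k arbitrary: a b f)
  case (Suc k)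
  then show ?case by (simp add: sum.swap[of _ I])
qed simp

lemma path_sum_cong:
  assumes "\<And>v. length v = 2 * k + 1 \<Longrightarrow> L v = L' v"
  shows "path_sum n k a b c d L = path_sum n k a b c d L'"
  using assms
proof (induction k arbitrary: a b L L')
  case (Suc k)
  show ?case unfolding path_sum.simps
    by (intro sum.cong refl Suc.IH) (simp add: Suc.prems)
qed simp

text \<open>An index is used by two units that lie two places apart, so exactly two consecutive
  indices \<open>s\<close>, \<open>t\<close> are shared across a cut: they end the left path and
  start the right one.\<close>

lemma path_sum_prod_split:
  assumes "b < n"
  shows "path_sum n k a b c d (prod_split \<rho> L) =
    (\<Sum>i<k. \<Sum>s<n. \<Sum>t<n. path_sum n i a b s t \<rho> * path_sum n (k - Suc i) s t c d L)"
  using assms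
proof (induction k arbitrary: a b \<rho>)
  case (Suc k)
  have "path_sum n (Suc k) a b c d (prod_split \<rho> L)
      = (\<Sum>j<n. \<rho> [Some (a, j)] * path_sum n k b j c d L)
      + (\<Sum>j<n. \<Sum>i<k. \<Sum>s<n. \<Sum>t<n. path_sum n i b j s t (\<lambda>u. \<rho> (Some (a, j) # None # u))
           * path_sum n (k - Suc i) s t c d L)"
    by (simp add: path_sum_add path_sum_mult Suc sum.distrib)
  also have "(\<Sum>j<n. \<Sum>i<k. \<Sum>s<n. \<Sum>t<n. path_sum n i b j s t (\<lambda>u. \<rho> (Some (a, j) # None # u))
           * path_sum n (k - Suc i) s t c d L)
      = (\<Sum>i<k. \<Sum>s<n. \<Sum>t<n. path_sum n (Suc i) a b s t \<rho> * path_sum n (k - Suc i) s t c d L)"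
  proof -
    have "(\<Sum>j<n. \<Sum>i<k. \<Sum>s<n. \<Sum>t<n. path_sum n i b j s t (\<lambda>u. \<rho> (Some (a, j) # None # u))
           * path_sum n (k - Suc i) s t c d L)
       = (\<Sum>i<k. \<Sum>s<n. \<Sum>t<n. \<Sum>j<n. path_sum n i b j s t (\<lambda>u. \<rho> (Some (a, j) # None # u))
           * path_sum n (k - Suc i) s t c d L)"
      by (rule trans[OF sum.swap], rule sum.cong[OF refl], rule trans[OF sum.swap],
          rule sum.cong[OF refl], rule sum.swap)
    then show ?thesis by (simp add: sum_distrib_right)
  qed
  also have "(\<Sum>j<n. \<rho> [Some (a, j)] * path_sum n k b j c d L)
     = (\<Sum>s<n. \<Sum>t<n. path_sum n 0 a b s t \<rho> * path_sum n k s t c d L)"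
  proof -
    have "(\<Sum>s<n. \<Sum>t<n. path_sum n 0 a b s t \<rho> * path_sum n k s t c d L)
        = (\<Sum>s<n. if b = s then \<Sum>t<n. \<rho> [Some (a, t)] * path_sum n k s t c d L else 0)"
      by (intro sum.cong refl) auto
    then show ?thesis using Suc.prems by simp
  qed
  finally show ?case unfolding sum.lessThan_Suc_shift by simp
qed simp

text \<open>The appended unit merges with the last letter, the one that carries \<open>d\<close>.
  The assumption on \<open>L\<close> covers all prefixes \<open>u\<close>, so it survives when
  leading letters are absorbed into \<open>L\<close>.\<close>

lemma path_sum_snoc:
  assumes "\<And>u i. i < n \<Longrightarrow> L (u @ [Some (i, d), Some (f, g)]) = (if d = f then L (u @ [Some (i, g)]) else 0)"
    and "a < n" "b < n"
  shows "path_sum n k a b c d (\<lambda>v. L (v @ [Some (f, g)])) = (if d = f then path_sum n k a b c g L else 0)"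
  using assms
proof (induction k arbitrary: a b L)
  case 0
  then show ?case using 0(1)[of a "[]"] by (cases "d = f") auto
next
  case (Suc k)
  have "path_sum n k b j c d (\<lambda>v. L (Some (a, j) # None # (v @ [Some (f, g)])))
     = (if d = f then path_sum n k b j c g (\<lambda>v. L (Some (a, j) # None # v)) else 0)" if "j < n" for j
    using Suc.prems(1)[of _ "Some (a, j) # None # u" for u] Suc.prems that
    by (intro Suc.IH) auto
  then show ?case by simp
qed

lemma path_sum_replace_first:
  assumes "\<And>j v. j < n \<Longrightarrow> G (Some (a', j) # v) = L (Some (a, j) # v)" "d < n"
  shows "path_sum n k a' b c d G = path_sum n k a b c d L"
  using assms by (cases k) auto

text \<open>\<open>unit_mult\<close> speaks of the end of a word, where the rotated unit meets the
  last letter of a path.\<close>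

locale matrix_word_functional = free_word_functional \<phi>
  for \<phi> :: "(nat \<times> nat) option list \<Rightarrow> complex" +
  fixes n :: nat and \<kappa> :: "nat \<Rightarrow> complex"
  assumes n: "n \<ge> 1"
    and unit_value: "i < n \<Longrightarrow> j < n \<Longrightarrow> \<phi> [Some (i, j)] = (if i = j then 1 / of_nat n else 0)"
    and unit_mult: "i < n \<Longrightarrow> j < n \<Longrightarrow> f < n \<Longrightarrow> g < n \<Longrightarrow>
      \<phi> (u @ [Some (i, j), Some (f, g)]) = (if j = f then \<phi> (u @ [Some (i, g)]) else 0)"
    and moments: "\<phi> (xpow k) = nc_moment \<kappa> k"
begin

text \<open>The target: the moments that belong to the cumulants claimed for the partial
  transpose.\<close>

definition pt_moment :: "nat \<Rightarrow> complex" where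
  "pt_moment = nc_moment (\<lambda>p. of_nat (cnp n p) * (\<kappa> p / of_nat n ^ p))"

text \<open>Each gap contributes a scalar and exchanges the two indices at its ends, whence the dependence on
  the parity of \<open>r\<close>.\<close>

lemma path_sum_gap_moment:
  assumes IH: "\<And>i a b c d. i \<le> K \<Longrightarrow> a < n \<Longrightarrow> b < n \<Longrightarrow> c < n \<Longrightarrow> d < n \<Longrightarrow>
      path_sum n i a b c d \<phi> = (if a = d \<and> b = c then pt_moment i / of_nat n else 0)"
    and "k \<le> K" "a < n" "b < n" "c < n" "d < n" "f < n" "g < n"
  shows "path_sum n k a b c d (\<lambda>v. gap_moment r (v @ [Some (f, g)])) =
    (if d = f \<and> (if even r then a = g \<and> b = c else b = g \<and> a = c)
     then conv_pow pt_moment r k / of_nat n ^ Suc r else 0)"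
  using assms(2-)
proof (induction r arbitrary: a b k)
  case 0
  have "path_sum n k a b c d (\<lambda>v. \<phi> (v @ [Some (f, g)])) = (if d = f then path_sum n k a b c g \<phi> else 0)"
    by (rule path_sum_snoc) (use 0 unit_mult in auto)
  then show ?case using 0 IH by auto
next
  case (Suc r)
  have "path_sum n k a b c d (\<lambda>v. gap_moment (Suc r) (v @ [Some (f, g)]))
      = path_sum n k a b c d (prod_split \<phi> (\<lambda>z. gap_moment r (z @ [Some (f, g)])))"
    by (simp add: prod_split_append)
  also have "\<dots> = (\<Sum>i<k. \<Sum>s<n. \<Sum>t<n. path_sum n i a b s t \<phi>
       * path_sum n (k - Suc i) s t c d (\<lambda>z. gap_moment r (z @ [Some (f, g)])))"
    using Suc.prems by (intro path_sum_prod_split) auto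
  \<comment> \<open>The value of the first gap forces \<open>s = b\<close> and \<open>t = a\<close>,
    so the remaining path starts with the exchanged pair.\<close>
  also have "\<dots> = (\<Sum>i<k. pt_moment i / of_nat n * path_sum n (k - Suc i) b a c d (\<lambda>z. gap_moment r (z @ [Some (f, g)])))"
  proof (rule sum.cong[OF refl])
    fix i assume i: "i \<in> {..<k}"
    define F where "F s t = path_sum n (k - Suc i) s t c d (\<lambda>z. gap_moment r (z @ [Some (f, g)]))" for s t
    have "(\<Sum>s<n. \<Sum>t<n. path_sum n i a b s t \<phi> * F s t)
       = (\<Sum>s<n. \<Sum>t<n. if a = t then (if b = s then pt_moment i / of_nat n * F s t else 0) else 0)"
      using i Suc.prems IH by (intro sum.cong refl) auto
    also have "\<dots> = pt_moment i / of_nat n * F b a"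
      using Suc.prems by simp
    finally show "(\<Sum>s<n. \<Sum>t<n. path_sum n i a b s t \<phi> * F s t) = pt_moment i / of_nat n * F b a" .
  qed
  also have "\<dots> = (\<Sum>i<k. pt_moment i / of_nat n * 
     (if d = f \<and> (if even r then b = g \<and> a = c else a = g \<and> b = c)
     then conv_pow pt_moment r (k - Suc i) / of_nat n ^ Suc r else 0))"
    using Suc.prems by (intro sum.cong refl arg_cong2[where f = "(*)"] Suc.IH) auto
  also have "\<dots> = (if d = f \<and> (if even (Suc r) then a = g \<and> b = c else b = g \<and> a = c)
     then conv_pow pt_moment (Suc r) k / of_nat n ^ Suc (Suc r) else 0)"
    by (auto simp: sum_divide_distrib mult_ac)
  finally show ?case .
qed

lemma path_sum_eq:
  assumes "a < n" "b < n" "c < n" "d < n"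
  shows "path_sum n k a b c d \<phi> = (if a = d \<and> b = c then pt_moment k / of_nat n else 0)"
  using assms
proof (induction k arbitrary: a b c d rule: less_induct)
  case (less k)
  show ?case
  proof (cases k)
    case 0
    then show ?thesis using less.prems by (simp add: unit_value pt_moment_def nc_moment_0)
  next
    case (Suc k')
    \<comment> \<open>The tail \<open>v\<close> has \<open>k' + 1\<close> units and
      \<open>k'\<close> letters \<open>x\<close>; the rotated unit adds one more letter.\<close>
    define K where "K = 2 * k' + 2"
    define C where "C r = \<kappa> (Suc r) * (conv_pow pt_moment r k' / of_nat n ^ Suc r)" for r
    define N where "N = (of_nat n :: complex)"
    have N: "N \<noteq> 0" using n by (simp add: N_def)
    have cum: "\<phi> (xpow (Suc l)) = (\<Sum>r\<le>l. \<kappa> (Suc r) * gap_moment r (xpow l))" for l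
      unfolding gap_moment_xpow moments nc_moment_Suc ..
    have exp: "\<phi> (Some (a, j) # None # v) = (\<Sum>r\<le>K. \<kappa> (Suc r) * gap_moment r (v @ [Some (a, j)]))"
      if "length v = 2 * k' + 1" for j v
    proof -
      have "\<phi> (Some (a, j) # None # v) = \<phi> (None # (v @ [Some (a, j)]))"
        using trace_letter[of "(a, j)" "None # v"] by simp
      also have "\<dots> = (\<Sum>r\<le>K. \<kappa> (Suc r) * gap_moment r (v @ [Some (a, j)]))"
        by (rule first_block_expansion[OF cum]) (simp add: that K_def)
      finally show ?thesis .
    qed
    have step: "path_sum n k' b j c d (\<lambda>v. gap_moment r (v @ [Some (a, j)])) = 
       (if d = a \<and> (if even r then b = j \<and> j = c else j = j \<and> b = c)
        then conv_pow pt_moment r k' / of_nat n ^ Suc r else 0)" if "j < n" for j r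
      by (rule path_sum_gap_moment[where K = k']) (use less Suc that in auto)
    have "path_sum n k a b c d \<phi>
      = (\<Sum>j<n. path_sum n k' b j c d (\<lambda>v. \<Sum>r\<le>K. \<kappa> (Suc r) * gap_moment r (v @ [Some (a, j)])))"
      unfolding Suc path_sum.simps by (intro sum.cong refl path_sum_cong exp)
    also have "\<dots> = (\<Sum>j<n. \<Sum>r\<le>K. \<kappa> (Suc r) * (if d = a \<and> (if even r then b = j \<and> j = c else j = j \<and> b = c)
        then conv_pow pt_moment r k' / of_nat n ^ Suc r else 0))"
      unfolding path_sum_sum path_sum_mult by (intro sum.cong refl arg_cong2[where f = "(*)"] step) auto
    \<comment> \<open>For even \<open>r\<close> the index \<open>j\<close> is tied to
      \<open>c\<close>; for odd \<open>r\<close>, that is for a block of even size, it is free and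
      its sum contributes \<open>n\<close>.\<close>
    also have "\<dots> = (\<Sum>r\<le>K. \<Sum>j<n. if d = a \<and> b = c then (if even r then (if j = c then C r else 0) else C r) else 0)"
      by (subst sum.swap) (auto intro!: sum.cong simp: C_def)
    also have "\<dots> = (if a = d \<and> b = c then \<Sum>r\<le>K. (if even r then 1 else N) * C r else 0)"
      using less.prems by (auto intro!: sum.cong simp: N_def)
    also have "(\<Sum>r\<le>K. (if even r then 1 else N) * C r) = (\<Sum>r\<le>k'. (if even r then 1 else N) * C r)"
      by (rule sum.mono_neutral_right) (auto simp: K_def C_def conv_pow_eq_0)
    also have "\<dots> = pt_moment k / N"
    proof -
      have "pt_moment (Suc k') = (\<Sum>r\<le>k'. of_nat (cnp n (Suc r)) * (\<kappa> (Suc r) / of_nat n ^ Suc r) * conv_pow pt_moment r k')"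
        unfolding pt_moment_def nc_moment_Suc ..
      \<comment> \<open>The common factor \<open>N\<close> turns \<open>1\<close> and
        \<open>N\<close> into the two values of \<open>cnp\<close>.\<close>
      also have "\<dots> = (\<Sum>r\<le>k'. N * ((if even r then 1 else N) * C r))"
        by (intro sum.cong refl) (simp add: cnp_def C_def N_def power2_eq_square)
      finally show ?thesis using N by (simp add: Suc sum_distrib_left[symmetric])
    qed
    finally show ?thesis by (simp add: N_def)
  qed
qed

end

section \<open>Existence of free cumulants\<close>

lemma NC_block:
  assumes "\<pi> \<in> NC p" "V \<in> \<pi>"
  shows "V \<subseteq> {0..<p}"
  using nc_on_block(1)[of \<pi> 0 p V] assms by (simp add: NC_eq_nc_on)

lemma NC_whole_block:
  assumes "\<pi> \<in> NC p" "{0..<p} \<in> \<pi>"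
  shows "\<pi> = {{0..<p}}"
proof -
  have p: "\<pi> \<in> nc_on 0 p" using assms by (simp add: NC_eq_nc_on)
  have "V = {0..<p}" if "V \<in> \<pi>" for V
    using nc_on_block(1,2)[OF p that] nc_on_unique[OF p that assms(2)] by blast
  then show ?thesis using assms(2) by blast
qed

lemma whole_in_NC: "p \<ge> 1 \<Longrightarrow> {{0..<p}} \<in> NC p"
  unfolding NC_eq_nc_on by (rule nc_onI) (auto simp: crossfree_def)

lemma length_nths_block:
  assumes "V \<subseteq> {0..<length ys}"
  shows "length (nths ys V) = card V"
proof -
  have "{i. i < length ys \<and> i \<in> V} = V" using assms by auto
  then show ?thesis by (simp add: length_nths)
qed

lemma NC_card_less:
  assumes "\<pi> \<in> NC p - {{{0..<p}}}" "V \<in> \<pi>"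
  shows "card V < p"
proof -
  have "V \<noteq> {0..<p}" using NC_whole_block assms by blast
  then have "V \<subset> {0..<p}" using NC_block[of \<pi> p V] assms by blast
  then show ?thesis using psubset_card_mono[of "{0..<p}" V] by simp
qed

lemma nths_list_update_notin: "i \<notin> V \<Longrightarrow> nths (ys[i := z]) V = nths ys V"
proof (induction ys arbitrary: i V)
  case (Cons y ys)
  then show ?case by (cases i) (auto simp: nths_Cons)
qed simp

text \<open>Linearity in an entry of \<open>ys\<close> thus becomes linearity in one entry of its
  block; the position \<open>j\<close> is the same for all \<open>z\<close>.\<close>

lemma nths_list_update_in:
  assumes "i \<in> V" "i < length ys"
  shows "\<exists>j<length (nths ys V). \<forall>z. nths (ys[i := z]) V = (nths ys V)[j := z]"
  using assms
proof (induction ys arbitrary: i V)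
  case (Cons y ys)
  show ?case
  proof (cases i)
    case 0
    then show ?thesis using Cons.prems by (intro exI[of _ 0]) (auto simp: nths_Cons)
  next
    case (Suc i')
    then obtain j where j: "j < length (nths ys {k. Suc k \<in> V})"
      "\<And>z. nths (ys[i' := z]) {k. Suc k \<in> V} = (nths ys {k. Suc k \<in> V})[j := z]"
      using Cons.IH[of i' "{k. Suc k \<in> V}"] Cons.prems by auto
    show ?thesis
      by (rule exI[of _ "if 0 \<in> V then Suc j else j"]) (use j Suc in \<open>auto simp: nths_Cons\<close>)
  qed
qed simp

text \<open>Cumulants depend only on the bilinear structure, so neither positivity nor the involution has to be
  treated for the matrix algebra.\<close>

locale bilinear_space =
  fixes S :: "('a, 'b) staralg_scheme"
  assumes un_carr: "un S \<in> carr S"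
    and pls_carr: "a \<in> carr S \<Longrightarrow> b \<in> carr S \<Longrightarrow> pls S a b \<in> carr S"
    and tms_carr: "a \<in> carr S \<Longrightarrow> b \<in> carr S \<Longrightarrow> tms S a b \<in> carr S"
    and scl_carr: "a \<in> carr S \<Longrightarrow> scl S \<alpha> a \<in> carr S"
    and tms_pls: "a \<in> carr S \<Longrightarrow> b \<in> carr S \<Longrightarrow> c \<in> carr S \<Longrightarrow> tms S a (pls S b c) = pls S (tms S a b) (tms S a c)"
    and pls_tms: "a \<in> carr S \<Longrightarrow> b \<in> carr S \<Longrightarrow> c \<in> carr S \<Longrightarrow> tms S (pls S a b) c = pls S (tms S a c) (tms S b c)"
    and scl_tms: "a \<in> carr S \<Longrightarrow> b \<in> carr S \<Longrightarrow> tms S (scl S \<alpha> a) b = scl S \<alpha> (tms S a b)"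
    and tms_scl: "a \<in> carr S \<Longrightarrow> b \<in> carr S \<Longrightarrow> tms S a (scl S \<alpha> b) = scl S \<alpha> (tms S a b)"
    and fn_pls: "a \<in> carr S \<Longrightarrow> b \<in> carr S \<Longrightarrow> fn S (pls S a b) = fn S a + fn S b"
    and fn_scl: "a \<in> carr S \<Longrightarrow> fn S (scl S \<alpha> a) = \<alpha> * fn S a"
begin

lemma lprod_carr: "set ys \<subseteq> carr S \<Longrightarrow> lprod S ys \<in> carr S"
  by (induction ys) (auto simp: un_carr tms_carr)

lemma lprod_linear:
  assumes "set ys \<subseteq> carr S" "i < length ys" "u \<in> carr S" "v \<in> carr S"
  shows "lprod S (ys[i := pls S (scl S \<alpha> u) v]) = pls S (scl S \<alpha> (lprod S (ys[i := u]))) (lprod S (ys[i := v]))"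
  using assms
proof (induction ys arbitrary: i)
  case (Cons y ys)
  show ?case
  proof (cases i)
    case 0
    then show ?thesis using Cons.prems lprod_carr[of ys]
      by (simp add: pls_tms scl_tms scl_carr)
  next
    case (Suc j)
    have "lprod S (ys[j := u]) \<in> carr S" "lprod S (ys[j := v]) \<in> carr S"
      using Cons.prems by (auto intro!: lprod_carr dest!: set_update_subset_insert[THEN subsetD])
    then show ?thesis using Cons Suc by (simp add: tms_pls tms_scl scl_carr)
  qed
qed simp

lemma fn_lprod_linear:
  assumes "set ys \<subseteq> carr S" "i < length ys" "u \<in> carr S" "v \<in> carr S"
  shows "fn S (lprod S (ys[i := pls S (scl S \<alpha> u) v])) = \<alpha> * fn S (lprod S (ys[i := u])) + fn S (lprod S (ys[i := v]))"
proof -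
  have "lprod S (ys[i := u]) \<in> carr S" "lprod S (ys[i := v]) \<in> carr S"
    using assms by (auto intro!: lprod_carr dest!: set_update_subset_insert[THEN subsetD])
  then show ?thesis using assms by (simp add: lprod_linear fn_pls fn_scl scl_carr)
qed

text \<open>The moment-cumulant formula solved for the one-block partition.\<close>

function cum :: "'a list \<Rightarrow> complex" where
  "cum ys = fn S (lprod S ys) - (\<Sum>\<pi>\<in>NC (length ys) - {{{0..<length ys}}}. \<Prod>V\<in>\<pi>. cum (nths ys V))"
  by pat_completeness auto
termination
proof (relation "measure length")
  fix ys :: "'a list" and \<pi> V
  assume "\<pi> \<in> NC (length ys) - {{{0..<length ys}}}" "V \<in> \<pi>"
  then show "(nths ys V, ys) \<in> measure length"
    using NC_card_less[of \<pi> "length ys" V] NC_block[of \<pi> "length ys" V]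
    by (simp add: length_nths_block)
qed simp

declare cum.simps[simp del]

text \<open>In each partition exactly one block contains \<open>i\<close>, so exactly one factor of
  the product varies, and it is linear by induction.\<close>

lemma cum_linear:
  assumes "set ys \<subseteq> carr S" "i < length ys" "u \<in> carr S" "v \<in> carr S"
  shows "cum (ys[i := pls S (scl S \<alpha> u) v]) = \<alpha> * cum (ys[i := u]) + cum (ys[i := v])"
  using assms
proof (induction "length ys" arbitrary: ys i rule: less_induct)
  case less
  let ?P = "NC (length ys) - {{{0..<length ys}}}"
  define t where "t z \<pi> = (\<Prod>V\<in>\<pi>. cum (nths (ys[i := z]) V))" for z \<pi>
  have "t (pls S (scl S \<alpha> u) v) \<pi> = \<alpha> * t u \<pi> + t v \<pi>" if pi: "\<pi> \<in> ?P" for \<pi>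
  proof -
    have p: "\<pi> \<in> nc_on 0 (length ys)" using pi by (simp add: NC_eq_nc_on)
    obtain V where V: "V \<in> \<pi>" "i \<in> V" using nc_on_cover[OF p _ less.prems(2)] by auto
    have fin: "finite \<pi>" by (rule nc_on_finite[OF p])
    have other: "nths (ys[i := z]) W = nths ys W" if "W \<in> \<pi> - {V}" for z W
    proof (rule nths_list_update_notin)
      show "i \<notin> W" using nc_on_unique[OF p V(1) _ V(2)] that by blast
    qed
    obtain j where j: "j < length (nths ys V)" "\<And>z. nths (ys[i := z]) V = (nths ys V)[j := z]"
      using nths_list_update_in[OF V(2) less.prems(2)] by blast
    have eq: "t z \<pi> = cum ((nths ys V)[j := z]) * (\<Prod>W\<in>\<pi> - {V}. cum (nths ys W))" for z
      unfolding t_def prod.remove[OF fin V(1)] j(2) using other by simp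
    have "length (nths ys V) < length ys"
      using NC_card_less[OF pi V(1)] nc_on_block(1)[OF p V(1)] by (simp add: length_nths_block)
    moreover have "set (nths ys V) \<subseteq> carr S"
      using set_nths_subset[of ys V] less.prems(1) by blast
    ultimately have "cum ((nths ys V)[j := pls S (scl S \<alpha> u) v])
        = \<alpha> * cum ((nths ys V)[j := u]) + cum ((nths ys V)[j := v])"
      using less.hyps j(1) less.prems(3,4) by blast
    then show ?thesis unfolding eq by (simp add: algebra_simps)
  qed
  then have "(\<Sum>\<pi>\<in>?P. t (pls S (scl S \<alpha> u) v) \<pi>) = \<alpha> * (\<Sum>\<pi>\<in>?P. t u \<pi>) + (\<Sum>\<pi>\<in>?P. t v \<pi>)"
    by (simp add: sum.distrib sum_distrib_left)
  moreover have "cum (ys[i := z]) = fn S (lprod S (ys[i := z])) - (\<Sum>\<pi>\<in>?P. t z \<pi>)" for z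
    unfolding t_def by (subst cum.simps) simp
  ultimately show ?case by (simp add: fn_lprod_linear[OF less.prems] right_diff_distrib)
qed

text \<open>This is the witness that gives meaning to the choice in \<open>free_cumulant\<close>.
  The order argument is ignored because \<open>cum\<close> reads it off the list.\<close>

lemma cumulant_family_cum: "cumulant_family S (\<lambda>_. cum)"
  unfolding cumulant_family_def
proof (intro conjI allI impI)
  fix ys assume ys: "ys \<noteq> [] \<and> set ys \<subseteq> carr S"
  let ?p = "length ys"
  have "?p \<ge> 1" using ys by (simp add: Suc_le_eq)
  have "(\<Sum>\<pi>\<in>NC ?p. \<Prod>V\<in>\<pi>. cum (nths ys V)) 
      = cum (nths ys {0..<?p}) + (\<Sum>\<pi>\<in>NC ?p - {{{0..<?p}}}. \<Prod>V\<in>\<pi>. cum (nths ys V))"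
    using sum.remove[OF _ whole_in_NC[OF \<open>?p \<ge> 1\<close>], of "\<lambda>\<pi>. \<Prod>V\<in>\<pi>. cum (nths ys V)"]
    by (simp add: NC_eq_nc_on finite_nc_on)
  also have "nths ys {0..<?p} = ys" by (rule nths_all) simp
  also have "cum ys + (\<Sum>\<pi>\<in>NC ?p - {{{0..<?p}}}. \<Prod>V\<in>\<pi>. cum (nths ys V)) = fn S (lprod S ys)"
    by (subst cum.simps) simp
  finally show "fn S (lprod S ys) = (\<Sum>\<pi>\<in>NC ?p. \<Prod>V\<in>\<pi>. cum (nths ys V))" by simp
qed (use cum_linear in blast)

text \<open>Any family that \<open>SOME\<close> may pick satisfies the moment formula, and on a
  constant list each factor depends only on the size of its block.\<close>

lemma moment_free_cumulant:
  assumes "y \<in> carr S" "p \<ge> 1"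
  shows "fn S (lprod S (replicate p y)) = nc_moment (\<lambda>r. free_cumulant S r (replicate r y)) p"
proof -
  define \<kappa> where "\<kappa> = (SOME \<kappa>. cumulant_family S \<kappa>)"
  have "cumulant_family S \<kappa>" unfolding \<kappa>_def by (rule someI[of "cumulant_family S", OF cumulant_family_cum])
  moreover have "replicate p y \<noteq> []" "set (replicate p y) \<subseteq> carr S" using assms by auto
  ultimately have "fn S (lprod S (replicate p y)) = (\<Sum>\<pi>\<in>NC p. \<Prod>V\<in>\<pi>. \<kappa> (card V) (nths (replicate p y) V))"
    unfolding cumulant_family_def by (metis length_replicate)
  also have "\<dots> = nc_moment (\<lambda>r. \<kappa> r (replicate r y)) p"
    unfolding nc_moment_def
  proof (intro sum.cong prod.cong refl arg_cong2[where f = \<kappa>])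
    fix \<pi> V assume "\<pi> \<in> NC p" "V \<in> \<pi>"
    then have "V \<subseteq> {0..<length (replicate p y)}" using NC_block by simp
    then have "length (nths (replicate p y) V) = card V" by (rule length_nths_block)
    moreover have "z = y" if "z \<in> set (nths (replicate p y) V)" for z
      using that set_nths_subset[of "replicate p y" V] by (cases p) auto
    ultimately show "nths (replicate p y) V = replicate (card V) y"
      by (intro replicate_eqI)
  qed
  finally show ?thesis unfolding free_cumulant_def \<kappa>_def .
qed

end

section \<open>Matrix units and compression\<close>

locale star_space =
  fixes S :: "'a staralg"
  assumes star_prob_space: "star_prob_space S"

sublocale star_space \<subseteq> bilinear_space S
  by unfold_locales (use star_prob_space in \<open>simp_all add: star_prob_space_def\<close>)

context star_space
begin

lemma zr_carr: "zr S \<in> carr S"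
  using star_prob_space by (simp_all add: star_prob_space_def)

lemma pls_assoc: "a \<in> carr S \<Longrightarrow> b \<in> carr S \<Longrightarrow> c \<in> carr S \<Longrightarrow> pls S (pls S a b) c = pls S a (pls S b c)"
proof -
  have "\<forall>a\<in>carr S. \<forall>b\<in>carr S. \<forall>c\<in>carr S. pls S (pls S a b) c = pls S a (pls S b c)"
    using star_prob_space unfolding star_prob_space_def by (elim conjE)
  then show "a \<in> carr S \<Longrightarrow> b \<in> carr S \<Longrightarrow> c \<in> carr S \<Longrightarrow> ?thesis" by simp
qed

lemma pls_commute: "a \<in> carr S \<Longrightarrow> b \<in> carr S \<Longrightarrow> pls S a b = pls S b a"
  using star_prob_space by (simp_all add: star_prob_space_def)

lemma pls_zr: "a \<in> carr S \<Longrightarrow> pls S a (zr S) = a"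
  using star_prob_space by (simp_all add: star_prob_space_def)

lemma pls_neg: "a \<in> carr S \<Longrightarrow> pls S a (scl S (-1) a) = zr S"
  using star_prob_space by (simp_all add: star_prob_space_def)

lemma scl_pls: "a \<in> carr S \<Longrightarrow> b \<in> carr S \<Longrightarrow> scl S \<alpha> (pls S a b) = pls S (scl S \<alpha> a) (scl S \<alpha> b)"
  using star_prob_space by (simp_all add: star_prob_space_def)

lemma scl_add: "a \<in> carr S \<Longrightarrow> scl S (\<alpha> + \<beta>) a = pls S (scl S \<alpha> a) (scl S \<beta> a)"
  using star_prob_space by (simp_all add: star_prob_space_def)

lemma scl_scl: "a \<in> carr S \<Longrightarrow> scl S \<alpha> (scl S \<beta> a) = scl S (\<alpha> * \<beta>) a"
  using star_prob_space by (simp_all add: star_prob_space_def)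

lemma scl_1: "a \<in> carr S \<Longrightarrow> scl S 1 a = a"
  using star_prob_space by (simp_all add: star_prob_space_def)

lemma tms_assoc: "a \<in> carr S \<Longrightarrow> b \<in> carr S \<Longrightarrow> c \<in> carr S \<Longrightarrow> tms S (tms S a b) c = tms S a (tms S b c)"
  using star_prob_space by (simp_all add: star_prob_space_def)

lemma tms_un: "a \<in> carr S \<Longrightarrow> tms S (un S) a = a" "a \<in> carr S \<Longrightarrow> tms S a (un S) = a"
  using star_prob_space by (simp_all add: star_prob_space_def)

lemma fn_un: "fn S (un S) = 1"
  using star_prob_space by (simp_all add: star_prob_space_def)

lemma scl_0: "a \<in> carr S \<Longrightarrow> scl S 0 a = zr S"
  using scl_add[of a 1 "-1"] by (simp add: scl_1 pls_neg)

lemma scl_zr: "scl S \<alpha> (zr S) = zr S"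
  using scl_scl[of "zr S" \<alpha> 0] by (simp add: scl_0 zr_carr)

lemma tms_zr: "a \<in> carr S \<Longrightarrow> tms S a (zr S) = zr S" "a \<in> carr S \<Longrightarrow> tms S (zr S) a = zr S"
  using tms_scl[of a "zr S" 0] scl_tms[of "zr S" a 0] by (simp_all add: scl_0 zr_carr tms_carr)

lemma fn_zr: "fn S (zr S) = 0"
  using fn_scl[of "zr S" 0] by (simp add: scl_0 zr_carr)

lemmas carr_intros = un_carr zr_carr pls_carr tms_carr scl_carr

lemma lprod_append:
  "set us \<subseteq> carr S \<Longrightarrow> set vs \<subseteq> carr S \<Longrightarrow> lprod S (us @ vs) = tms S (lprod S us) (lprod S vs)"
  by (induction us) (auto simp: tms_un lprod_carr tms_assoc)

lemma lprod_replicate_scl: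
  assumes "x \<in> carr S"
  shows "lprod S (replicate k (scl S t x)) = scl S (t ^ k) (lprod S (replicate k x))"
proof (induction k)
  case 0
  then show ?case by (simp add: scl_1 un_carr)
next
  case (Suc k)
  have "lprod S (replicate k x) \<in> carr S" using assms by (intro lprod_carr) auto
  then show ?case using assms
    by (simp add: Suc scl_tms tms_scl scl_carr tms_carr scl_scl mult.commute)
qed

lemma rsum_carr: "(\<And>i. i < k \<Longrightarrow> f i \<in> carr S) \<Longrightarrow> rsum S f k \<in> carr S"
  by (induction k) (auto simp: zr_carr pls_carr)

lemma fn_rsum:
  "u \<in> carr S \<Longrightarrow> (\<And>i. i < k \<Longrightarrow> f i \<in> carr S) \<Longrightarrow> fn S (tms S u (rsum S f k)) = (\<Sum>i<k. fn S (tms S u (f i)))"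
  by (induction k) (auto simp: tms_zr fn_zr tms_pls rsum_carr fn_pls tms_carr)

lemma rsum_pls:
  assumes "\<And>i. i < k \<Longrightarrow> f i \<in> carr S" "\<And>i. i < k \<Longrightarrow> g i \<in> carr S"
  shows "rsum S (\<lambda>i. pls S (f i) (g i)) k = pls S (rsum S f k) (rsum S g k)"
  using assms
proof (induction k)
  case 0
  then show ?case by (simp add: pls_zr zr_carr)
next
  case (Suc k)
  define a b c d where "a = rsum S f k" "b = rsum S g k" "c = f k" "d = g k"
  have "a \<in> carr S" "b \<in> carr S" "c \<in> carr S" "d \<in> carr S"
    using Suc.prems by (auto simp: a_b_c_d_def rsum_carr)
  then have "pls S (pls S a b) (pls S c d) = pls S (pls S a c) (pls S b d)"
    by (metis pls_assoc pls_commute pls_carr)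
  then show ?case using Suc by (simp add: a_b_c_d_def)
qed

lemma rsum_scl:
  "(\<And>i. i < k \<Longrightarrow> f i \<in> carr S) \<Longrightarrow> rsum S (\<lambda>i. scl S \<alpha> (f i)) k = scl S \<alpha> (rsum S f k)"
  by (induction k) (auto simp: scl_zr scl_pls rsum_carr)

end

lemma rsum_cong: "(\<And>i. i < k \<Longrightarrow> f i = g i) \<Longrightarrow> rsum S f k = rsum S g k"
  by (induction k) auto

lemma rsum_compress: "rsum (compress S q m) f k = rsum S f k"
  by (induction k) (auto simp: compress_def)

lemma compress_simps [simp]:
  "pls (compress S q m) = pls S" "tms (compress S q m) = tms S" "scl (compress S q m) = scl S"
  "zr (compress S q m) = zr S" "un (compress S q m) = q" "fn (compress S q m) a = of_nat m * fn S a"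
  by (simp_all add: compress_def)

lemma mat_alg_simps [simp]:
  "pls (mat_alg n R) M N = (\<lambda>i j. if i < n \<and> j < n then pls R (M i j) (N i j) else zr R)"
  "tms (mat_alg n R) M N = (\<lambda>i j. if i < n \<and> j < n then rsum R (\<lambda>k. tms R (M i k) (N k j)) n else zr R)"
  "scl (mat_alg n R) \<alpha> M = (\<lambda>i j. if i < n \<and> j < n then scl R \<alpha> (M i j) else zr R)"
  "un (mat_alg n R) = (\<lambda>i j. if i < n \<and> j < n \<and> i = j then un R else zr R)"
  "fn (mat_alg n R) M = (\<Sum>i<n. fn R (M i i)) / of_nat n"
  by (simp_all add: mat_alg_def)

context star_space
begin

text \<open>The fixed points of \<open>a \<mapsto> q a q\<close> describe the corner by an equation,
  from which its closure properties follow by calculation.\<close>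

lemma carr_compress:
  assumes "q \<in> carr S" "tms S q q = q"
  shows "carr (compress S q m) = {a \<in> carr S. tms S (tms S q a) q = a}"
proof -
  have "tms S (tms S q (tms S (tms S q a) q)) q = tms S (tms S q a) q" if a: "a \<in> carr S" for a
  proof -
    have "tms S q (tms S (tms S q a) q) = tms S (tms S q a) q"
      using a assms by (metis tms_assoc tms_carr)
    then show ?thesis using a assms by (metis tms_assoc tms_carr)
  qed
  then show ?thesis using assms by (auto simp: compress_def tms_carr) metis
qed

lemma bilinear_space_mat_compress:
  assumes q: "q \<in> carr S" "tms S q q = q"
  shows "bilinear_space (mat_alg n (compress S q m))"
proof -
  let ?R = "compress S q m" and ?M = "mat_alg n (compress S q m)"
  note cR = carr_compress[OF q]
  have RS: "a \<in> carr S" if "a \<in> carr ?R" for a using that by (simp add: cR)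
  have R_zr: "zr S \<in> carr ?R" and R_un: "q \<in> carr ?R"
    using q by (simp_all add: cR tms_zr zr_carr)
  have R_pls: "pls S a b \<in> carr ?R" if "a \<in> carr ?R" "b \<in> carr ?R" for a b
    using that q by (simp add: cR pls_carr tms_pls pls_tms tms_carr)
  have R_scl: "scl S \<alpha> a \<in> carr ?R" if "a \<in> carr ?R" for \<alpha> a
    using that q by (simp add: cR scl_carr tms_scl scl_tms tms_carr)
  have R_tms: "tms S a b \<in> carr ?R" if ab: "a \<in> carr ?R" "b \<in> carr ?R" for a b
  proof -
    have ab': "a \<in> carr S" "b \<in> carr S" "tms S (tms S q a) q = a" "tms S (tms S q b) q = b"
      using ab by (auto simp: cR)
    have "tms S q a = a" "tms S b q = b" using ab' q by (metis tms_assoc tms_carr)+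
    then have "tms S (tms S q (tms S a b)) q = tms S a b"
      using ab' q by (metis tms_assoc tms_carr)
    then show ?thesis using ab' by (simp add: cR tms_carr)
  qed
  have R_rsum: "rsum S f k \<in> carr ?R" if "\<And>i. i < k \<Longrightarrow> f i \<in> carr ?R" for f k
    using that by (induction k) (auto simp: R_zr R_pls)
  have carrI: "N \<in> carr ?M" if "\<And>i j. i < n \<Longrightarrow> j < n \<Longrightarrow> N i j \<in> carr ?R"
    "\<And>i j. \<not> (i < n \<and> j < n) \<Longrightarrow> N i j = zr S" for N
    using that by (simp add: mat_alg_def)
  have carrD: "N i j \<in> carr ?R" if "N \<in> carr ?M" "i < n" "j < n" for N i j
    using that by (simp add: mat_alg_def)
  note S_carr = carrD[THEN RS]
  note rs = rsum_compress
  show ?thesis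
  proof
    show "un ?M \<in> carr ?M" by (rule carrI) (auto simp: R_un R_zr)
  next
    fix a b assume ab: "a \<in> carr ?M" "b \<in> carr ?M"
    show "pls ?M a b \<in> carr ?M" by (rule carrI) (auto simp: R_pls carrD ab)
    show "tms ?M a b \<in> carr ?M" by (rule carrI) (auto simp: rs carrD ab intro!: R_rsum R_tms)
    show "scl ?M \<alpha> a \<in> carr ?M" for \<alpha> by (rule carrI) (auto simp: R_scl carrD ab)
    show "fn ?M (pls ?M a b) = fn ?M a + fn ?M b"
      by (simp add: S_carr ab fn_pls distrib_left sum.distrib add_divide_distrib)
    show "fn ?M (scl ?M \<alpha> a) = \<alpha> * fn ?M a" for \<alpha>
      by (simp add: S_carr ab fn_scl sum_distrib_left mult.left_commute)
    have prod: "tms S (a i k) (b k j) \<in> carr S" if "i < n" "j < n" "k < n" for i j k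
      using that by (simp add: tms_carr S_carr ab)
    show "tms ?M (scl ?M \<alpha> a) b = scl ?M \<alpha> (tms ?M a b)" for \<alpha>
    proof (intro ext)
      fix i j
      have "rsum S (\<lambda>k. tms S (scl S \<alpha> (a i k)) (b k j)) n = scl S \<alpha> (rsum S (\<lambda>k. tms S (a i k) (b k j)) n)"
        if "i < n" "j < n"
        using that by (subst rsum_scl[symmetric]) (auto simp: prod scl_tms S_carr ab intro!: rsum_cong)
      moreover have "rsum S (\<lambda>k. tms S (if i < n \<and> k < n then scl S \<alpha> (a i k) else zr S) (b k j)) n
          = rsum S (\<lambda>k. tms S (scl S \<alpha> (a i k)) (b k j)) n" if "i < n"
        using that by (auto intro!: rsum_cong)
      ultimately show "tms ?M (scl ?M \<alpha> a) b i j = scl ?M \<alpha> (tms ?M a b) i j" by (simp add: rs cong: if_cong)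
    qed
    show "tms ?M a (scl ?M \<alpha> b) = scl ?M \<alpha> (tms ?M a b)" for \<alpha>
    proof (intro ext)
      fix i j
      have "rsum S (\<lambda>k. tms S (a i k) (scl S \<alpha> (b k j))) n = scl S \<alpha> (rsum S (\<lambda>k. tms S (a i k) (b k j)) n)"
        if "i < n" "j < n"
        using that by (subst rsum_scl[symmetric]) (auto simp: prod tms_scl S_carr ab intro!: rsum_cong)
      moreover have "rsum S (\<lambda>k. tms S (a i k) (if k < n \<and> j < n then scl S \<alpha> (b k j) else zr S)) n
          = rsum S (\<lambda>k. tms S (a i k) (scl S \<alpha> (b k j))) n" if "j < n"
        using that by (auto intro!: rsum_cong)
      ultimately show "tms ?M a (scl ?M \<alpha> b) i j = scl ?M \<alpha> (tms ?M a b) i j" by (simp add: rs cong: if_cong)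
    qed
    fix c assume c: "c \<in> carr ?M"
    have prod': "tms S (a i k) (c k j) \<in> carr S" "tms S (b i k) (c k j) \<in> carr S"
      if "i < n" "j < n" "k < n" for i j k
      using that by (simp_all add: tms_carr S_carr ab c)
    show "tms ?M a (pls ?M b c) = pls ?M (tms ?M a b) (tms ?M a c)"
    proof (intro ext)
      fix i j
      have "rsum S (\<lambda>k. tms S (a i k) (pls S (b k j) (c k j))) n
          = pls S (rsum S (\<lambda>k. tms S (a i k) (b k j)) n) (rsum S (\<lambda>k. tms S (a i k) (c k j)) n)"
        if "i < n" "j < n"
        using that by (subst rsum_pls[symmetric]) (auto simp: prod prod' tms_pls S_carr ab c intro!: rsum_cong)
      moreover have "rsum S (\<lambda>k. tms S (a i k) (if k < n \<and> j < n then pls S (b k j) (c k j) else zr S)) n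
          = rsum S (\<lambda>k. tms S (a i k) (pls S (b k j) (c k j))) n" if "j < n"
        using that by (auto intro!: rsum_cong)
      ultimately show "tms ?M a (pls ?M b c) i j = pls ?M (tms ?M a b) (tms ?M a c) i j" by (simp add: rs cong: if_cong)
    qed
    show "tms ?M (pls ?M a b) c = pls ?M (tms ?M a c) (tms ?M b c)"
    proof (intro ext)
      fix i j
      have "rsum S (\<lambda>k. tms S (pls S (a i k) (b i k)) (c k j)) n
          = pls S (rsum S (\<lambda>k. tms S (a i k) (c k j)) n) (rsum S (\<lambda>k. tms S (b i k) (c k j)) n)"
        if "i < n" "j < n"
        using that by (subst rsum_pls[symmetric]) (auto simp: prod' pls_tms S_carr ab c intro!: rsum_cong)
      moreover have "rsum S (\<lambda>k. tms S (if i < n \<and> k < n then pls S (a i k) (b i k) else zr S) (c k j)) n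
          = rsum S (\<lambda>k. tms S (pls S (a i k) (b i k)) (c k j)) n" if "i < n"
        using that by (auto intro!: rsum_cong)
      ultimately show "tms ?M (pls ?M a b) c i j = pls ?M (tms ?M a c) (tms ?M b c) i j" by (simp add: rs cong: if_cong)
    qed
  qed
qed

end

section \<open>Words evaluated at \<open>x\<close> and the matrix units\<close>

locale free_matrix_units = star_space +
  fixes n :: nat and e :: "nat \<Rightarrow> nat \<Rightarrow> 'a" and x :: 'a
  assumes n: "n \<ge> 1"
    and units: "matrix_units S n e"
    and x: "x \<in> carr S"
    and free_x: "free_indep S {x} {e i j | i j. i < n \<and> j < n}"
begin

lemma e_carr: "i < n \<Longrightarrow> j < n \<Longrightarrow> e i j \<in> carr S"
  using units by (simp add: matrix_units_def)

lemma e_mult: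
  "i < n \<Longrightarrow> j < n \<Longrightarrow> k < n \<Longrightarrow> l < n \<Longrightarrow> tms S (e i j) (e k l) = (if j = k then e i l else zr S)"
  using units by (simp add: matrix_units_def)

lemma fn_e: "i < n \<Longrightarrow> j < n \<Longrightarrow> fn S (e i j) = (if i = j then 1 / of_nat n else 0)"
  using units by (simp add: matrix_units_def)

text \<open>Letters out of range go to \<open>zr S\<close>, which lies in \<open>carr S\<close> and
  in the algebra generated by the units, so freeness and closure hold for all words.\<close>

fun ev :: "(nat \<times> nat) option \<Rightarrow> 'a" where
  "ev None = x"
| "ev (Some (i, j)) = (if i < n \<and> j < n then e i j else zr S)"

definition evw :: "(nat \<times> nat) option list \<Rightarrow> 'a" where
  "evw w = lprod S (map ev w)"

definition mom :: "(nat \<times> nat) option list \<Rightarrow> complex" where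
  "mom w = fn S (evw w)"

lemma ev_carr: "ev l \<in> carr S"
  by (cases l rule: ev.cases) (auto simp: x e_carr zr_carr)

lemma evw_carr: "evw w \<in> carr S"
  unfolding evw_def by (intro lprod_carr) (auto simp: ev_carr)

lemma evw_Nil: "evw [] = un S"
  by (simp add: evw_def)

lemma evw_Cons: "evw (l # w) = tms S (ev l) (evw w)"
  by (simp add: evw_def)

lemma evw_append: "evw (u @ v) = tms S (evw u) (evw v)"
  unfolding evw_def by (simp add: lprod_append image_subset_iff ev_carr)

interpretation word_functional mom .

abbreviation centred :: "(nat \<times> nat) option list \<Rightarrow> 'a" where
  "centred c \<equiv> pls S (evw c) (scl S (- mom c) (un S))"

lemma fn_centred: "fn S (centred c) = 0"
  by (simp add: fn_pls fn_scl scl_carr evw_carr un_carr fn_un mom_def)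

text \<open>The formal expansion becomes a genuine product in the algebra; \<open>u\<close> collects
  the blocks already passed.\<close>

lemma ctr_mom:
  assumes "u \<in> carr S"
  shows "ctr (\<lambda>v. fn S (tms S u (evw v))) cs = fn S (tms S u (lprod S (map centred cs)))"
  using assms
proof (induction cs arbitrary: u)
  case Nil
  then show ?case by (simp add: evw_Nil)
next
  case (Cons c cs)
  define P where "P = lprod S (map centred cs)"
  have P: "P \<in> carr S" unfolding P_def by (intro lprod_carr) (auto simp: carr_intros evw_carr)
  have "ctr (\<lambda>v. fn S (tms S u (evw (c @ v)))) cs = ctr (\<lambda>v. fn S (tms S (tms S u (evw c)) (evw v))) cs"
    using Cons.prems by (simp add: evw_append tms_assoc evw_carr)
  also have "\<dots> = fn S (tms S (tms S u (evw c)) P)"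
    unfolding P_def using Cons.prems by (intro Cons.IH) (simp add: tms_carr evw_carr)
  finally have "ctr (\<lambda>v. fn S (tms S u (evw v))) (c # cs) = fn S (tms S u (tms S (evw c) P)) - mom c * fn S (tms S u P)"
    using Cons by (simp add: P_def[symmetric] tms_assoc evw_carr P)
  also have "\<dots> = fn S (tms S u (tms S (centred c) P))"
    using P Cons.prems
    by (simp add: pls_tms scl_tms tms_un tms_pls tms_scl carr_intros evw_carr fn_pls fn_scl)
  finally show ?case by (simp add: P_def)
qed

lemma evw_gen_alg: "(\<And>l. l \<in> set w \<Longrightarrow> ev l \<in> gen_alg S X) \<Longrightarrow> evw w \<in> gen_alg S X"
  by (induction w) (auto simp: evw_Nil evw_Cons intro: gen_alg.intros)

lemma alt_nth:
  "alt t cs \<Longrightarrow> k < length cs \<Longrightarrow> l \<in> set (cs ! k) \<Longrightarrow> (l = None) = (t = even k)"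
proof (induction cs arbitrary: t k)
  case (Cons c cs)
  then show ?case by (cases k) auto
qed simp

lemma ctr_mom_free:
  assumes alt: "alt t cs" and "cs \<noteq> []"
  shows "ctr mom cs = 0"
proof -
  let ?E = "{e i j | i j. i < n \<and> j < n}"
  have zrE: "zr S \<in> gen_alg S ?E"
    using gen_alg.scale[OF gen_alg.unit, of S 0 ?E] by (simp add: scl_0 un_carr)
  define ls where "ls = map (\<lambda>k. t = even k) [0..<length cs]"
  have "ctr mom cs = ctr (\<lambda>v. fn S (tms S (un S) (evw v))) cs"
    by (simp add: tms_un evw_carr mom_def[abs_def])
  also have "\<dots> = fn S (tms S (un S) (lprod S (map centred cs)))"
    by (rule ctr_mom[OF un_carr])
  also have "\<dots> = fn S (lprod S (map centred cs))"
    by (subst tms_un) (auto intro!: lprod_carr simp: carr_intros evw_carr)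
  also have "\<dots> = 0"
  proof (rule free_x[unfolded free_indep_def, rule_format, of "map centred cs" ls], intro conjI allI impI)
    show "length (map centred cs) = length ls" "map centred cs \<noteq> []"
      using assms by (simp_all add: ls_def)
    show "ls ! k \<noteq> ls ! Suc k" if "Suc k < length ls" for k
      using that by (auto simp: ls_def)
  next
    fix k assume k: "k < length (map centred cs)"
    show "fn S (map centred cs ! k) = 0" using k by (simp add: fn_centred)
    have "evw (cs ! k) \<in> gen_alg S (if ls ! k then {x} else ?E)"
    proof (rule evw_gen_alg)
      fix l assume "l \<in> set (cs ! k)"
      then have "(l = None) = (ls ! k)" using alt_nth[OF alt] k by (simp add: ls_def)
      then show "ev l \<in> gen_alg S (if ls ! k then {x} else ?E)"
        using zrE by (cases l rule: ev.cases) (auto intro: gen_alg.gen)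
    qed
    then show "map centred cs ! k \<in> gen_alg S (if ls ! k then {x} else ?E)"
      using k by (auto intro!: gen_alg.plus gen_alg.scale gen_alg.unit)
  qed
  finally show ?thesis .
qed

lemma evw_units:
  assumes "None \<notin> set w"
  shows "evw w = un S \<or> evw w = zr S \<or> (\<exists>i<n. \<exists>j<n. evw w = e i j)"
  using assms
proof (induction w)
  case (Cons l w)
  then obtain i j where "l = Some (i, j)" by (cases l) auto
  then show ?case using Cons
    by (simp add: evw_Cons) (elim disjE exE conjE;
      auto simp: tms_zr zr_carr tms_un un_carr e_carr e_mult evw_carr)
qed (simp add: evw_Nil)

text \<open>Words in the units reduce to \<open>un S\<close>, \<open>zr S\<close> or a single unit,
  and the values on the units make the two orders of a product agree.\<close>

lemma mom_trace:
  assumes "None \<notin> set u" "None \<notin> set v"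
  shows "mom (u @ v) = mom (v @ u)"
  unfolding mom_def evw_append
  using evw_units[OF assms(1)] evw_units[OF assms(2)]
  by (auto simp: tms_zr zr_carr tms_un un_carr e_carr e_mult fn_e fn_zr)

text \<open>These weights produce the moments of \<open>x\<close>. Written through the cumulants of
  \<open>x/n\<close>, their powers of \<open>n\<close> cancel in the final comparison.\<close>

definition kap :: "nat \<Rightarrow> complex" where
  "kap p = of_nat n ^ p * free_cumulant S p (replicate p (scl S (1 / of_nat n) x))"

lemma mom_x_power: "mom (replicate k None) = nc_moment kap k"
proof (cases "k = 0")
  case True
  then show ?thesis by (simp add: mom_def evw_Nil fn_un nc_moment_0)
next
  case False
  have xk: "lprod S (replicate k x) \<in> carr S" using x by (intro lprod_carr) auto
  have "nc_moment kap k = of_nat n ^ k * fn S (lprod S (replicate k (scl S (1 / of_nat n) x)))"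
    using False moment_free_cumulant[of "scl S (1 / of_nat n) x" k] scl_carr[OF x]
    unfolding kap_def nc_moment_scale by simp
  also have "\<dots> = fn S (lprod S (replicate k x))"
    using n by (simp add: lprod_replicate_scl x fn_scl xk power_divide)
  finally show ?thesis by (simp add: mom_def evw_def)
qed

sublocale matrix_word_functional mom n kap
proof
  show "mom [] = 1" by (simp add: mom_def evw_Nil fn_un)
  show "ctr mom cs = 0" if "alt t cs" "cs \<noteq> []" for t cs
    by (rule ctr_mom_free[OF that])
  show "mom (u @ v) = mom (v @ u)" if "None \<notin> set u" "None \<notin> set v" for u v
    by (rule mom_trace[OF that])
  show "mom [Some (i, j)] = (if i = j then 1 / of_nat n else 0)" if "i < n" "j < n" for i j
    using that by (simp add: mom_def evw_Cons evw_Nil tms_un e_carr fn_e)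
  show "mom (u @ [Some (i, j), Some (f, g)]) = (if j = f then mom (u @ [Some (i, g)]) else 0)"
    if "i < n" "j < n" "f < n" "g < n" for u i j f g
    using that by (simp add: mom_def evw_append evw_Cons evw_Nil tms_un e_carr e_mult tms_zr evw_carr fn_zr)
qed (fact n mom_x_power)+

section \<open>Powers of the partial transpose\<close>

abbreviation "MM \<equiv> mat_alg n (compress S (e 0 0) n)"

abbreviation "XG \<equiv> xGamma S n e x"

lemma XG_entry: "i < n \<Longrightarrow> j < n \<Longrightarrow> XG i j = tms S (tms S (e 0 j) x) (e i 0)"
  by (simp add: xGamma_def)

lemma XG_entry_carr: "i < n \<Longrightarrow> j < n \<Longrightarrow> XG i j \<in> carr S"
  using n by (simp add: XG_entry tms_carr e_carr x)

lemma idem: "e 0 0 \<in> carr S" "tms S (e 0 0) (e 0 0) = e 0 0"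
  using n by (simp_all add: e_carr e_mult)

lemma XG_carr: "XG \<in> carr MM"
proof -
  have "tms S (tms S (e 0 0) (XG i j)) (e 0 0) = XG i j" if "i < n" "j < n" for i j
  proof -
    have "tms S (e 0 0) (e 0 j) = e 0 j" "tms S (e i 0) (e 0 0) = e i 0"
      using n that by (simp_all add: e_mult)
    moreover have "tms S (tms S (e 0 0) (tms S (tms S (e 0 j) x) (e i 0))) (e 0 0)
        = tms S (tms S (tms S (e 0 0) (e 0 j)) x) (tms S (e i 0) (e 0 0))"
      using n that by (simp add: tms_assoc tms_carr e_carr x)
    ultimately show ?thesis unfolding XG_entry[OF that] by simp
  qed
  then show ?thesis
    by (auto simp: mat_alg_def carr_compress[OF idem] XG_entry_carr) (auto simp: xGamma_def)
qed

lemma XG_power_entry_carr: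
  "a < n \<Longrightarrow> c < n \<Longrightarrow> lprod MM (replicate p XG) a c \<in> carr S"
  by (induction p arbitrary: a c)
    (auto simp: idem zr_carr rsum_compress XG_entry_carr intro!: rsum_carr tms_carr)

text \<open>Each entry of the matrix begins with some \<open>e 0 j\<close> and ends with some
  \<open>e i 0\<close>, whence the outer indices \<open>0\<close>; row and column of the power are
  the next ones inwards. The factor \<open>u\<close> takes up entries already multiplied
  out.\<close>

lemma XG_power_entry:
  assumes "u \<in> carr S" "a < n" "c < n"
  shows "fn S (tms S u (lprod MM (replicate p XG) a c)) = path_sum n p 0 a c 0 (\<lambda>v. fn S (tms S u (evw v)))"
  using assms
proof (induction p arbitrary: u a)
  case 0
  then show ?case using n by (simp add: evw_Cons evw_Nil tms_un idem tms_zr fn_zr)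
next
  case (Suc p)
  let ?Z = "lprod MM (replicate p XG)"
  have n0: "0 < n" using n by simp
  have "fn S (tms S u (lprod MM (replicate (Suc p) XG) a c))
      = (\<Sum>b<n. fn S (tms S u (tms S (XG a b) (?Z b c))))"
    using Suc.prems by (simp add: rsum_compress fn_rsum tms_carr XG_entry_carr XG_power_entry_carr)
  also have "\<dots> = (\<Sum>b<n. path_sum n p a b c 0 (\<lambda>v. fn S (tms S u (evw (Some (0, b) # None # v)))))"
  proof (rule sum.cong[OF refl])
    fix b assume "b \<in> {..<n}"
    then have b: "b < n" by simp
    have "fn S (tms S u (tms S (XG a b) (?Z b c))) = fn S (tms S (tms S u (XG a b)) (?Z b c))"
      using Suc.prems b by (simp add: tms_assoc XG_entry_carr XG_power_entry_carr)
    also have "\<dots> = path_sum n p 0 b c 0 (\<lambda>v. fn S (tms S (tms S u (XG a b)) (evw v)))"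
      using Suc.prems b by (intro Suc.IH) (simp_all add: tms_carr XG_entry_carr)
    \<comment> \<open>The final \<open>e a 0\<close> of the entry meets the leading
      \<open>e 0 j\<close> of the next word, so \<open>a\<close> replaces \<open>0\<close> as its
      first index.\<close>
    also have "\<dots> = path_sum n p a b c 0 (\<lambda>v. fn S (tms S u (evw (Some (0, b) # None # v))))"
    proof (rule path_sum_replace_first[OF _ n0])
      fix j v assume j: "j < n"
      have "tms S (e a 0) (tms S (e 0 j) (evw v)) = tms S (e a j) (evw v)"
        using j n0 Suc.prems by (simp add: tms_assoc[symmetric] e_carr evw_carr e_mult)
      then show "fn S (tms S (tms S u (XG a b)) (evw (Some (0, j) # v)))
          = fn S (tms S u (evw (Some (0, b) # None # Some (a, j) # v)))"
        using j b n0 Suc.prems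
        by (simp add: XG_entry evw_Cons tms_assoc tms_carr e_carr x evw_carr)
    qed
    finally show "fn S (tms S u (tms S (XG a b) (?Z b c))) = \<dots>" .
  qed
  finally show ?case by simp
qed

text \<open>Each diagonal entry contributes the moment divided by \<open>n\<close>, and the
  normalisation of the compressed state cancels this division.\<close>

lemma XG_moment: "fn MM (lprod MM (replicate p XG)) = pt_moment p"
proof -
  have "fn S (lprod MM (replicate p XG) a a) = pt_moment p / of_nat n" if a: "a < n" for a
  proof -
    have "fn S (lprod MM (replicate p XG) a a) = fn S (tms S (un S) (lprod MM (replicate p XG) a a))"
      using a by (simp add: tms_un XG_power_entry_carr)
    also have "\<dots> = path_sum n p 0 a a 0 mom"
      unfolding XG_power_entry[OF un_carr a a] by (simp add: tms_un evw_carr mom_def[abs_def])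
    also have "\<dots> = pt_moment p / of_nat n" using a n by (simp add: path_sum_eq)
    finally show ?thesis .
  qed
  then show ?thesis using n by simp
qed

lemma free_cumulant_XG:
  assumes "p \<ge> 1"
  shows "free_cumulant MM p (replicate p XG)
    = of_nat (cnp n p) * free_cumulant S p (replicate p (scl S (1 / of_nat n) x))"
proof -
  interpret M: bilinear_space MM by (rule bilinear_space_mat_compress[OF idem])
  define w where "w = (\<lambda>p. of_nat (cnp n p) * (kap p / of_nat n ^ p))"
  have "nc_moment (\<lambda>r. free_cumulant MM r (replicate r XG)) k = nc_moment w k" for k
  proof (cases "k = 0")
    case False
    then show ?thesis
      using M.moment_free_cumulant[OF XG_carr, of k] XG_moment[of k]
      by (simp add: pt_moment_def w_def del: mat_alg_simps)
  qed (simp add: nc_moment_0)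
  from nc_moment_inject[OF this assms] show ?thesis
    using n by (simp add: w_def kap_def)
qed

end

theorem theorem1:
  fixes S :: "'a staralg" and e :: "nat \<Rightarrow> nat \<Rightarrow> 'a" and x :: 'a and n p :: nat
  assumes "n \<ge> 1"
    and "star_prob_space S"
    and "matrix_units S n e"
    and "x \<in> carr S" and "st S x = x"
    and "free_indep S {x} {e i j | i j. i < n \<and> j < n}"
    and "p \<ge> 1"
  shows "free_cumulant (mat_alg n (compress S (e 0 0) n)) p (replicate p (xGamma S n e x))
       = of_nat (cnp n p) * free_cumulant S p (replicate p (scl S (1 / of_nat n) x))"
proof -
  interpret free_matrix_units S n e x
    by unfold_locales (fact assms)+
  show ?thesis by (rule free_cumulant_XG[OF assms(7)])
qed

end
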